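(* Let $\mu\in\mathcal{W}$. Then there exist $0<p,q<\infty$ such that $AT^q_p(\mu)\neq AL^q_p(\mu)$.
   Context: $\mathbb{D}$ is the open unit disc, $\mathbb{T}=\partial\mathbb{D}$, $\mathcal{H}(\mathbb{D})$ is the space of analytic functions in $\mathbb{D}$, and $dA=\frac{dx\,dy}{\pi}$. A weight is a function $\omega:\mathbb{D}\to[0,\infty)$ integrable over $\mathbb{D}$; it is radial if $\omega(z)=\omega(|z|)$ for all $z\in\mathbb{D}$. The class $\mathcal{W}$ of rapidly decreasing weights consists of the radial weights $\omega$ satisfying: (1) $\omega=e^{-\varphi}$, where $\varphi\in C^2(\mathbb{D})$ is a radial function whose Laplacian satisfies $\Delta\varphi\ge B_\varphi>0$ in $\mathbb{D}$ for some positive constant $B_\varphi$ depending only on $\varphi$; (2) $(\Delta\varphi)^{-1/2}\asymp\tau$ (comparable up to positive multiplicative constants), where $\tau$ is a radial positive differentiable function that decreases to $0$ as $|z|\to1^-$, and $\lim_{r\to1^-}\tau'(r)=0$; (3) there exists a constant $C>0$ such that either $\tau(r)(1-r)^{-C}$ is increasing for $r$ close to $1$, or $\lim_{r\to1^-}\tau'(r)\log\frac1{\tau(r)}=0$. For $\xi\in\overline{\mathbb{D}}$, $\Gamma(\xi)=\{z\in\mathbb{D}:|\arg z-\arg\xi|<|\xi|-|z|\}$ (difference of arguments modulo $2\pi$). For $0<p,q<\infty$ and a radial weight $\omega$, $L^q_p(\omega)$ and $T^q_p(\omega)$ consist of the complex-valued measurable functions $f$ on $\mathbb{D}$ such that,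 respectively, $$\|f\|_{L^q_p(\omega)}=\left(\frac1{2\pi}\int_0^{2\pi}\left(\int_0^1|f(re^{i\theta})|^p\omega(r)r\,dr\right)^{q/p}d\theta\right)^{1/q}<\infty,$$ $$\|f\|_{T^q_p(\omega)}=\left(\int_{\mathbb{T}}\left(\int_{\Gamma(\xi)}|f(z)|^p\omega(z)\frac{dA(z)}{1-|z|}\right)^{q/p}|d\xi|\right)^{1/q}<\infty.$$ Set $AL^q_p(\omega)=L^q_p(\omega)\cap\mathcal{H}(\mathbb{D})$ and $AT^q_p(\omega)=T^q_p(\omega)\cap\mathcal{H}(\mathbb{D})$. *)

theory Defs
  imports "HOL-Analysis.Analysis"
begin

abbreviation unit_disc :: "complex set" where
  "unit_disc \<equiv> ball 0 1"

section \<open>Weights\<close>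

text \<open>Functions on the disc are modelled by functions on the whole plane; no notion below depends
  on values outside the disc.\<close>

definition radial :: "(complex \<Rightarrow> real) \<Rightarrow> bool" where
  "radial \<omega> \<longleftrightarrow> (\<forall>z\<in>unit_disc. \<omega> z = \<omega> (of_real (norm z)))"

definition weight :: "(complex \<Rightarrow> real) \<Rightarrow> bool" where
  "weight \<omega> \<longleftrightarrow> (\<forall>z\<in>unit_disc. 0 \<le> \<omega> z) \<and> set_integrable lebesgue unit_disc \<omega>"

text \<open>Twice continuously real-differentiable on an open set: \<open>D\<close> and \<open>H\<close> are the first and second
  Frechet derivatives, the complex plane being regarded as a real vector space.\<close>

definition C2_on :: "complex set \<Rightarrow> (complex \<Rightarrow> real) \<Rightarrow> bool" where
  "C2_on S \<phi> \<longleftrightarrow>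
     (\<exists>(D :: complex \<Rightarrow> complex \<Rightarrow>\<^sub>L real) (H :: complex \<Rightarrow> complex \<Rightarrow>\<^sub>L (complex \<Rightarrow>\<^sub>L real)).
        (\<forall>z\<in>S. (\<phi> has_derivative blinfun_apply (D z)) (at z)) \<and>
        (\<forall>z\<in>S. (D has_derivative blinfun_apply (H z)) (at z)) \<and>
        continuous_on S H)"

text \<open>Here \<^term>\<open>Basis :: complex set\<close> is \<open>{1, \<i>}\<close>, so this is the sum of the two pure second
  partial derivatives with respect to the real and the imaginary part.\<close>

definition laplacian :: "(complex \<Rightarrow> real) \<Rightarrow> complex \<Rightarrow> real" where
  "laplacian \<phi> z =
     (\<Sum>b\<in>Basis. frechet_derivative (\<lambda>w. frechet_derivative \<phi> (at w) b) (at z) b)"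

text \<open>The radial function \<open>\<tau>\<close> is represented by its profile on \<open>[0,1)\<close>, i.e. it is
  \<open>z \<mapsto> \<tau> \<bar>z\<bar>\<close>; differentiability and monotonicity refer to the profile.\<close>

definition rapidly_decreasing_weights :: "(complex \<Rightarrow> real) set" where
  "rapidly_decreasing_weights = {\<omega>. weight \<omega> \<and> radial \<omega> \<and>
     (\<exists>\<phi> :: complex \<Rightarrow> real.
        (\<forall>z\<in>unit_disc. \<omega> z = exp (- \<phi> z)) \<and>
        C2_on unit_disc \<phi> \<and> radial \<phi> \<and>
        (\<exists>B>0. \<forall>z\<in>unit_disc. laplacian \<phi> z \<ge> B) \<and>
        (\<exists>\<tau> :: real \<Rightarrow> real.
           (\<exists>c>0. \<exists>C>0. \<forall>z\<in>unit_disc.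
              c * \<tau> (norm z) \<le> laplacian \<phi> z powr (-1/2) \<and>
              laplacian \<phi> z powr (-1/2) \<le> C * \<tau> (norm z)) \<and>
           (\<forall>r\<in>{0..<1}. \<tau> r > 0) \<and>
           \<tau> differentiable_on {0..<1} \<and>
           antimono_on {0..<1} \<tau> \<and>
           (\<tau> \<longlongrightarrow> 0) (at_left 1) \<and>
           (deriv \<tau> \<longlongrightarrow> 0) (at_left 1) \<and>
           (\<exists>C>0. (\<exists>r0\<in>{0..<1}. mono_on {r0..<1} (\<lambda>r. \<tau> r * (1 - r) powr (- C))) \<or>
                  ((\<lambda>r. deriv \<tau> r * ln (1 / \<tau> r)) \<longlongrightarrow> 0) (at_left 1))))}"

section \<open>The spaces\<close>

text \<open>Quantifying over all arguments of \<open>z\<close> and \<open>\<xi>\<close> makes the difference of the arguments one modulo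
  \<open>2 * pi\<close>. Every real number is an argument of \<open>0\<close>, so \<open>0\<close> lies in the region whenever
  \<open>\<xi> \<noteq> 0\<close>.\<close>

definition tent_region :: "complex \<Rightarrow> complex set" where
  "tent_region \<xi> = {z\<in>unit_disc. \<exists>s t. is_Arg z s \<and> is_Arg \<xi> t \<and> \<bar>s - t\<bar> < norm \<xi> - norm z}"

text \<open>Only used for positive exponents.\<close>

definition ennreal_rpow :: "ennreal \<Rightarrow> real \<Rightarrow> ennreal" where
  "ennreal_rpow x a = (if x = \<infinity> then \<infinity> else ennreal (enn2real x powr a))"

definition L_norm :: "real \<Rightarrow> real \<Rightarrow> (complex \<Rightarrow> real) \<Rightarrow> (complex \<Rightarrow> complex) \<Rightarrow> ennreal" where
  "L_norm p q \<omega> f =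
     ennreal_rpow
       (ennreal (1 / (2 * pi)) *
        (\<integral>\<^sup>+\<theta>\<in>{0..2 * pi}.
           ennreal_rpow
             (\<integral>\<^sup>+r\<in>{0..<1}. ennreal (norm (f (of_real r * cis \<theta>)) powr p * \<omega> (of_real r) * r) \<partial>lebesgue)
             (q / p)
         \<partial>lebesgue))
       (1 / q)"

text \<open>The arc length integral over the unit circle is written in the parameter \<open>\<xi> = cis \<theta>\<close>; the
  factor \<open>1 / pi\<close> comes from the normalised area measure.\<close>

definition T_norm :: "real \<Rightarrow> real \<Rightarrow> (complex \<Rightarrow> real) \<Rightarrow> (complex \<Rightarrow> complex) \<Rightarrow> ennreal" where
  "T_norm p q \<omega> f =
     ennreal_rpow
       (\<integral>\<^sup>+\<theta>\<in>{0..2 * pi}.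
          ennreal_rpow
            (ennreal (1 / pi) *
             (\<integral>\<^sup>+z\<in>tent_region (cis \<theta>). ennreal (norm (f z) powr p * \<omega> z / (1 - norm z)) \<partial>lebesgue))
            (q / p)
        \<partial>lebesgue)
       (1 / q)"

definition L_space :: "real \<Rightarrow> real \<Rightarrow> (complex \<Rightarrow> real) \<Rightarrow> (complex \<Rightarrow> complex) set" where
  "L_space p q \<omega> = {f \<in> borel_measurable (lebesgue_on unit_disc). L_norm p q \<omega> f < \<infinity>}"

definition T_space :: "real \<Rightarrow> real \<Rightarrow> (complex \<Rightarrow> real) \<Rightarrow> (complex \<Rightarrow> complex) set" where
  "T_space p q \<omega> = {f \<in> borel_measurable (lebesgue_on unit_disc). T_norm p q \<omega> f < \<infinity>}"

definition AL_space :: "real \<Rightarrow> real \<Rightarrow> (complex \<Rightarrow> real) \<Rightarrow> (complex \<Rightarrow> complex) set" where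
  "AL_space p q \<omega> = L_space p q \<omega> \<inter> {f. f holomorphic_on unit_disc}"

definition AT_space :: "real \<Rightarrow> real \<Rightarrow> (complex \<Rightarrow> real) \<Rightarrow> (complex \<Rightarrow> complex) set" where
  "AT_space p q \<omega> = T_space p q \<omega> \<inter> {f. f holomorphic_on unit_disc}"

end

theory Submission
  imports
    Defs
    "HOL-Complex_Analysis.Cauchy_Integral_Formula"
    "HOL-Real_Asymp.Real_Asymp"
begin

text \<open>The proof takes \<open>p = 1\<close> and \<open>q = 1/2\<close>. The conditions on \<open>\<tau>\<close> give \<open>(1 - r)\<^sup>2 \<Delta>\<phi> \<longrightarrow> \<infinity>\<close>, so \<open>\<mu>\<close> decays
  faster than every power of \<open>1 - r\<close>. Hence the measures \<open>r ^ n \<mu>(r) r dr\<close> have, for infinitely many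
  \<open>n\<close>, a relative variance of \<open>1 - r\<close> as small as we please, and concentrate where
  \<open>1 - r\<close> is comparable to its mean \<open>e\<close>. For \<open>m\<close> of order \<open>1 / e\<close> and a large constant \<open>A\<close>, the modulus
  of \<open>z ^ n * exp (A * z ^ m)\<close> then has on the relevant circles \<open>m\<close> narrow peaks at angular distance
  about \<open>e\<close>. The cone with any vertex contains such a peak, so that the tent norm averages the peaks out,
  whereas the radial integrals see them only in a small set of directions; since \<open>q < p\<close>, the latter
  is much cheaper. A gliding hump sums such functions to an element of \<open>AL\<close> all of whose integrals
  over cones are infinite.\<close>

section \<open>Decay of rapidly decreasing weights\<close>

text \<open>Concavity of the square root is the engine. An inner radial integral of size
  \<open>X\<close> on a set of directions of measure \<open>\<delta>\<close> costs
  \<open>\<delta> * sqrt X\<close> in the \<open>L\<close> quantity, whereas a cone receives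
  \<open>X\<close> times the relative width \<open>A powr (-1/2)\<close> of the peaks. With
  \<open>\<delta>\<close> a little larger than that width, the first can tend to 0 while the second
  is kept at any prescribed level. The obstacle is that nothing but fast decay is known of the
  profile of \<open>\<mu>\<close>: the radial mass of \<open>z ^ n\<close> might spread over several
  scales of \<open>1 - r\<close>, and then no single \<open>m\<close> would give peaks that are
  dense enough for the cones and still pronounced, which requires \<open>r ^ m\<close> to be bounded
  below. Concentration at one scale \<open>e\<close> settles both, with \<open>m * e\<close> between
  8 and 9. It is obtained only along a sequence of \<open>n\<close>, which is enough because each
  stage of the hump construction uses one \<open>n\<close>.\<close>

lemma radial_laplacian:
  fixes \<phi> :: "complex \<Rightarrow> real"
  assumes C2: "C2_on unit_disc \<phi>" and rad: "radial \<phi>"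
  obtains \<psi>' where
    "\<And>r. 0 < r \<Longrightarrow> r < 1 \<Longrightarrow> ((\<lambda>x. \<phi> (of_real x)) has_real_derivative \<psi>' r) (at r)"
    "\<And>r. 0 < r \<Longrightarrow> r < 1 \<Longrightarrow>
       ((\<lambda>x. x * \<psi>' x) has_real_derivative r * laplacian \<phi> (of_real r)) (at r)"
proof -
  obtain D :: "complex \<Rightarrow> complex \<Rightarrow>\<^sub>L real" and H :: "complex \<Rightarrow> complex \<Rightarrow>\<^sub>L (complex \<Rightarrow>\<^sub>L real)"
    where D: "\<And>z. z \<in> unit_disc \<Longrightarrow> (\<phi> has_derivative blinfun_apply (D z)) (at z)"
      and H: "\<And>z. z \<in> unit_disc \<Longrightarrow> (D has_derivative blinfun_apply (H z)) (at z)"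
    using C2 unfolding C2_on_def by blast
  have fd: "frechet_derivative \<phi> (at z) = blinfun_apply (D z)" if "z \<in> unit_disc" for z
    using frechet_derivative_at[OF D[OF that]] by simp
  have Db: "((\<lambda>w. D w b) has_derivative (\<lambda>v. H z v b)) (at z)" if "z \<in> unit_disc" for z b
    using bounded_linear.has_derivative[OF blinfun.bounded_linear_left H[OF that]] by simp
  have lap: "laplacian \<phi> z = H z 1 1 + H z \<i> \<i>" if z: "z \<in> unit_disc" for z
  proof -
    have "((\<lambda>w. frechet_derivative \<phi> (at w) b) has_derivative (\<lambda>v. H z v b)) (at z)" for b
      by (rule has_derivative_transform_within_open[OF Db[OF z] open_ball z]) (simp add: fd)
    from frechet_derivative_at[OF this]
    have "frechet_derivative (\<lambda>w. frechet_derivative \<phi> (at w) b) (at z) = (\<lambda>v. H z v b)" for b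
      by simp
    then show ?thesis unfolding laplacian_def by (simp add: Basis_complex_def)
  qed
  have rad': "\<phi> (of_real (norm z)) = \<phi> z" if "z \<in> unit_disc" for z
    using rad that unfolding radial_def by metis
  define \<psi>' where "\<psi>' r = D (of_real r) 1" for r :: real
  have d1: "((\<lambda>x. \<phi> (of_real x)) has_real_derivative \<psi>' r) (at r)" if "\<bar>r\<bar> < 1" for r
  proof -
    have "((\<lambda>x. \<phi> (of_real x)) has_derivative (\<lambda>h. D (of_real r) (of_real h))) (at r)"
      by (rule has_derivative_compose[OF _ D])
        (use that in \<open>auto intro!: derivative_eq_intros\<close>)
    moreover have "D (of_real r) (of_real h) = \<psi>' r * h" for h
      using blinfun.scaleR_right[of "D (of_real r)" h 1]
      by (simp add: \<psi>'_def scaleR_conv_of_real mult.commute)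
    ultimately show ?thesis by (simp add: has_field_derivative_def)
  qed
  have d2: "(\<psi>' has_real_derivative H (of_real r) 1 1) (at r)" if "\<bar>r\<bar> < 1" for r
  proof -
    have "((\<lambda>x. D (of_real x) 1) has_derivative (\<lambda>h. H (of_real r) (of_real h) 1)) (at r)"
      by (rule has_derivative_compose[OF _ Db])
        (use that in \<open>auto intro!: derivative_eq_intros\<close>)
    moreover have "H (of_real r) (of_real h) 1 = H (of_real r) 1 1 * h" for h
    proof -
      have "complex_of_real h = h *\<^sub>R 1" by (simp add: scaleR_conv_of_real)
      then show ?thesis by (simp only: blinfun.scaleR_right blinfun.scaleR_left) simp
    qed
    ultimately show ?thesis by (simp add: has_field_derivative_def \<psi>'_def[abs_def])
  qed
  \<comment> \<open>Away from 0 the chain rule through \<open>norm\<close> applies, and radiality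
    identifies the composite with \<open>\<phi>\<close>.\<close>
  have Di: "D w \<i> = \<psi>' (norm w) * (Im w / norm w)" if w: "w \<in> unit_disc" "w \<noteq> 0" for w
  proof -
    have "((\<lambda>x. \<phi> (of_real x)) has_derivative (\<lambda>h. \<psi>' (norm w) * h)) (at (norm w))"
      using d1[of "norm w"] w by (simp add: has_field_derivative_def)
    then have "((\<lambda>z. \<phi> (of_real (norm z))) has_derivative
        (\<lambda>v. \<psi>' (norm w) * (v \<bullet> sgn w))) (at w)"
      by (rule has_derivative_compose[OF has_derivative_norm[OF w(2)]])
    then have "(\<phi> has_derivative (\<lambda>v. \<psi>' (norm w) * (v \<bullet> sgn w))) (at w)"
      by (rule has_derivative_transform_within_open[OF _ open_ball w(1)])
        (rule rad')
    from has_derivative_unique[OF D[OF w(1)] this] 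
    have "D w \<i> = \<psi>' (norm w) * (\<i> \<bullet> sgn w)" by (simp add: fun_eq_iff)
    then show ?thesis by (simp add: inner_complex_def sgn_div_norm divide_inverse mult_ac)
  qed
  \<comment> \<open>On the vertical line through \<open>of_real r\<close>, \<open>Di\<close> makes
    the difference quotient of \<open>D (?p y) \<i>\<close> equal to \<open>k y\<close> for small
    nonzero \<open>y\<close>, because the imaginary part is \<open>y\<close> and vanishes at the
    base point. Its limit is the first-order term of the polar Laplacian, so no second derivative of
    the norm is computed.\<close>
  have Hii: "H (of_real r) \<i> \<i> = \<psi>' r / r" if r: "0 < r" "r < 1" for r
  proof -
    let ?p = "\<lambda>y::real. of_real r + \<i> * of_real y :: complex"
    have r': "complex_of_real r \<in> unit_disc" using r by simp
    have "((\<lambda>y. D (?p y) \<i>) has_derivative (\<lambda>h. H (?p 0) (\<i> * of_real h) \<i>)) (at 0)"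
      by (rule has_derivative_compose[OF _ Db])
        (use r in \<open>auto intro!: derivative_eq_intros\<close>)
    moreover have "H (of_real r) (\<i> * of_real h) \<i> = H (of_real r) \<i> \<i> * h" for h
    proof -
      have "\<i> * complex_of_real h = h *\<^sub>R \<i>" by (simp add: scaleR_conv_of_real)
      then show ?thesis by (simp only: blinfun.scaleR_right blinfun.scaleR_left) simp
    qed
    ultimately have A: "((\<lambda>y. D (?p y) \<i>) has_real_derivative H (of_real r) \<i> \<i>) (at 0)"
      by (simp add: has_field_derivative_def)
    define k where "k y = \<psi>' (norm (?p y)) / norm (?p y)" for y
    have ev: "eventually (\<lambda>y. ?p y \<in> unit_disc - {0}) (at 0)"
    proof -
      have "open (unit_disc - {0::complex})" by auto
      moreover have "(?p \<longlongrightarrow> ?p 0) (at 0)" by (intro tendsto_intros)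
      ultimately show ?thesis using r by (intro topological_tendstoD) auto
    qed
    have nt: "((\<lambda>y. norm (?p y)) \<longlongrightarrow> r) (at 0)"
      using r by (auto intro!: tendsto_eq_intros)
    have "((\<lambda>y. \<psi>' (norm (?p y))) \<longlongrightarrow> \<psi>' r) (at 0)"
      using DERIV_isCont[OF d2[of r]] r nt by (intro isCont_tendsto_compose[of r \<psi>']) auto
    with nt r have kt: "(k \<longlongrightarrow> \<psi>' r / r) (at 0)"
      unfolding k_def by (intro tendsto_intros) auto
    have "((\<lambda>y. (D (?p y) \<i> - D (?p 0) \<i>) / (y - 0)) \<longlongrightarrow> \<psi>' r / r) (at 0)"
    proof (rule Lim_transform_eventually[OF kt])
      have "eventually (\<lambda>y::real. y \<noteq> 0) (at 0)" by (simp add: eventually_at_filter)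
      with ev show "eventually (\<lambda>y. k y = (D (?p y) \<i> - D (?p 0) \<i>) / (y - 0)) (at 0)"
        by eventually_elim (use Di[OF r'] r in \<open>auto simp: Di k_def divide_simps\<close>)
    qed
    then have "((\<lambda>y. D (?p y) \<i>) has_real_derivative \<psi>' r / r) (at 0)"
      by (simp add: has_field_derivative_iff)
    with A show ?thesis by (rule DERIV_unique)
  qed
  show thesis
  proof
    fix r :: real assume r: "0 < r" "r < 1"
    show "((\<lambda>x. \<phi> (of_real x)) has_real_derivative \<psi>' r) (at r)" using d1 r by simp
    have "((\<lambda>x. x * \<psi>' x) has_real_derivative (\<psi>' r + H (of_real r) 1 1 * r)) (at r)"
      using DERIV_mult[OF DERIV_ident d2[of r]] r by (simp add: algebra_simps)
    moreover have "\<psi>' r + H (of_real r) 1 1 * r = r * laplacian \<phi> (of_real r)"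
      using lap[of "of_real r"] Hii[OF r] r by (simp add: field_simps)
    ultimately show "((\<lambda>x. x * \<psi>' x) has_real_derivative r * laplacian \<phi> (of_real r)) (at r)" by simp
  qed
qed

lemma at_left_one_obtain:
  assumes "eventually P (at_left (1::real))"
  obtains a where "0 < a" "a < 1" "\<And>r. a < r \<Longrightarrow> r < 1 \<Longrightarrow> P r"
proof -
  have "\<exists>b<1. \<forall>r>b. r < 1 \<longrightarrow> P r"
    using assms eventually_at_left[of 0 "1::real" P] by simp
  then obtain b where b: "b < 1" "\<And>r. b < r \<Longrightarrow> r < 1 \<Longrightarrow> P r"
    by blast
  show thesis by (rule that[of "max b (1/2)"]) (use b(1) in \<open>simp_all add: b(2)\<close>)
qed

text \<open>The mean value theorem on \<open>[r, s]\<close> gives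
  \<open>\<tau> r \<le> \<tau> s + \<epsilon> * (s - r)\<close>, and \<open>\<tau> s\<close>
  vanishes as \<open>s\<close> tends to 1. Since \<open>\<epsilon>\<close> is arbitrary,
  \<open>\<tau>\<close> is of smaller order than \<open>1 - r\<close>.\<close>

lemma vanishing_derivative_imp_small:
  fixes \<tau> :: "real \<Rightarrow> real"
  assumes diff: "\<tau> differentiable_on {0..<1}"
    and lim: "(\<tau> \<longlongrightarrow> 0) (at_left 1)" and dlim: "(deriv \<tau> \<longlongrightarrow> 0) (at_left 1)"
    and "0 < \<epsilon>"
  obtains a where "0 < a" "a < 1" "\<And>r. a < r \<Longrightarrow> r < 1 \<Longrightarrow> \<tau> r \<le> \<epsilon> * (1 - r)"
proof -
  have "eventually (\<lambda>r. \<bar>deriv \<tau> r\<bar> < \<epsilon>) (at_left 1)"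
    using order_tendstoD(2)[OF tendsto_rabs[OF dlim]] \<open>0 < \<epsilon>\<close> by simp
  then obtain a where a: "0 < a" "a < 1" and small: "\<And>r. a < r \<Longrightarrow> r < 1 \<Longrightarrow> \<bar>deriv \<tau> r\<bar> < \<epsilon>"
    by (rule at_left_one_obtain) blast
  have der: "(\<tau> has_real_derivative deriv \<tau> r) (at r)" if "0 < r" "r < 1" for r
  proof -
    have "\<tau> differentiable_on {0<..<1}"
      by (rule differentiable_on_subset[OF diff]) auto
    then have "\<tau> differentiable (at r)"
      using that by (auto simp: differentiable_on_eq_differentiable_at)
    then show ?thesis
      by (simp add: field_differentiable_derivI field_differentiable_def
          real_differentiable_def)
  qed
  show thesis
  proof (rule that[OF a])
    fix r assume r: "a < r" "r < 1"
    show "\<tau> r \<le> \<epsilon> * (1 - r)"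
    proof (rule tendsto_lowerbound)
      show "((\<lambda>s. \<tau> s + \<epsilon> * (1 - r)) \<longlongrightarrow> \<epsilon> * (1 - r)) (at_left 1)"
        using tendsto_add[OF lim tendsto_const[of "\<epsilon> * (1 - r)"]] by simp
      have "eventually (\<lambda>s. r < s \<and> s < 1) (at_left (1::real))"
        using r eventually_at_left by auto
      then show "eventually (\<lambda>s. \<tau> r \<le> \<tau> s + \<epsilon> * (1 - r)) (at_left 1)"
      proof eventually_elim
        case (elim s)
        obtain x where x: "r < x" "x < s" "\<tau> s - \<tau> r = (s - r) * deriv \<tau> x"
          using MVT2[of r s \<tau> "deriv \<tau>"] der elim a r by force
        have "- ((s - r) * \<epsilon>) \<le> (s - r) * deriv \<tau> x"
          using small[of x] x elim r mult_left_mono[of "- \<epsilon>" "deriv \<tau> x" "s - r"] by auto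
        moreover have "(s - r) * \<epsilon> \<le> (1 - r) * \<epsilon>"
          using elim \<open>0 < \<epsilon>\<close> by (intro mult_right_mono) auto
        ultimately show ?case using x(3) by (simp add: mult.commute)
      qed
    qed simp
  qed
qed

text \<open>Two integrations of the Laplacian turn a lower bound of order
  \<open>Q / (1 - r)\<^sup>2\<close> into \<open>\<phi> \<ge> - Q / 2 * ln (1 - r) - L\<close> near
  the circle, so \<open>\<mu>\<close> is bounded there by a constant times
  \<open>(1 - r) powr (Q / 2)\<close>, with \<open>Q\<close> at free disposal.\<close>

lemma rapidly_decreasing_weight_decay:
  assumes "\<mu> \<in> rapidly_decreasing_weights"
  shows "radial \<mu>" and "continuous_on unit_disc \<mu>" and "\<And>z. z \<in> unit_disc \<Longrightarrow> 0 < \<mu> z"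
    and "\<exists>C. \<forall>r\<in>{0..<1}. \<mu> (of_real r) \<le> C * (1 - r) ^ k"
proof -
  obtain \<phi> B \<tau> c1 c where rad: "radial \<mu>" and \<mu>0: "\<forall>z\<in>unit_disc. \<mu> z = exp (- \<phi> z)"
    and C2: "C2_on unit_disc \<phi>" and rad\<phi>: "radial \<phi>"
    and B: "B > 0" "\<forall>z\<in>unit_disc. laplacian \<phi> z \<ge> B"
    and c: "c > 0" and c0: "\<forall>z\<in>unit_disc. c1 * \<tau> (norm z) \<le> laplacian \<phi> z powr (-1/2) \<and>
      laplacian \<phi> z powr (-1/2) \<le> c * \<tau> (norm z)"
    and \<tau>: "\<tau> differentiable_on {0..<1}" "(\<tau> \<longlongrightarrow> 0) (at_left 1)" "(deriv \<tau> \<longlongrightarrow> 0) (at_left 1)"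
    using assms unfolding rapidly_decreasing_weights_def mem_Collect_eq
    by (elim conjE exE bexE) blast
  have \<mu>: "\<mu> z = exp (- \<phi> z)" and lap_le: "laplacian \<phi> z powr (-1/2) \<le> c * \<tau> (norm z)"
    and pos: "0 < laplacian \<phi> z" if "z \<in> unit_disc" for z
    using that \<mu>0 c0 B by (blast, blast, force intro: less_le_trans)
  show "radial \<mu>" by fact
  show "0 < \<mu> z" if "z \<in> unit_disc" for z using \<mu>[OF that] by simp
  have "continuous_on unit_disc \<phi>"
    using C2 unfolding C2_on_def
    by (meson continuous_at_imp_continuous_on has_derivative_continuous)
  then have "continuous_on unit_disc (\<lambda>z. exp (- \<phi> z))" by (intro continuous_intros)
  then show cont: "continuous_on unit_disc \<mu>" 
    by (rule continuous_on_eq) (simp add: \<mu>)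
  \<comment> \<open>The Laplacian will be at least \<open>2 * Q / (1 - r)\<^sup>2\<close>. Half is
    lost to the factor \<open>r \<ge> 1/2\<close>, half again to the integration constant
    \<open>K\<close>, and the remaining \<open>Q / 2 = 2 * k + 2\<close> exceeds
    \<open>k\<close>.\<close>
  define Q where "Q = 4 * real k + 4"
  have Q: "0 < Q" by (simp add: Q_def)
  define \<epsilon> where "\<epsilon> = 1 / (c * sqrt (2 * Q))"
  have \<epsilon>: "0 < \<epsilon>" using c Q by (simp add: \<epsilon>_def)
  obtain a where a: "0 < a" "a < 1" and small: "\<And>r. a < r \<Longrightarrow> r < 1 \<Longrightarrow> \<tau> r \<le> \<epsilon> * (1 - r)"
    by (rule vanishing_derivative_imp_small[OF \<tau> \<epsilon>]) blast
  obtain \<psi>' where d1: "\<And>r. 0 < r \<Longrightarrow> r < 1 \<Longrightarrow>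
       ((\<lambda>x. \<phi> (of_real x)) has_real_derivative \<psi>' r) (at r)"
    and d2: "\<And>r. 0 < r \<Longrightarrow> r < 1 \<Longrightarrow>
       ((\<lambda>x. x * \<psi>' x) has_real_derivative r * laplacian \<phi> (of_real r)) (at r)"
    by (rule radial_laplacian[OF C2 rad\<phi>]) blast
  have lap: "2 * Q / (1 - r)\<^sup>2 \<le> laplacian \<phi> (of_real r)" if r: "a < r" "r < 1" for r
  proof -
    let ?L = "laplacian \<phi> (of_real r)"
    have L: "0 < ?L" using pos[of "of_real r"] r a by simp
    have "1 / sqrt ?L = ?L powr (-1/2)"
      using L powr_minus_divide[of ?L "1/2"] by (simp add: powr_half_sqrt)
    also have "\<dots> \<le> c * \<tau> r" using lap_le[of "of_real r"] r a by simp
    also have "\<dots> \<le> c * (\<epsilon> * (1 - r))" using small[OF r] c by simp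
    also have "\<dots> = (1 - r) / sqrt (2 * Q)" using c by (simp add: \<epsilon>_def)
    finally have "sqrt (2 * Q) / (1 - r) \<le> sqrt ?L" using L Q r by (simp add: field_simps)
    then have "(sqrt (2 * Q) / (1 - r))\<^sup>2 \<le> (sqrt ?L)\<^sup>2" using r Q by (intro power_mono) auto
    then show ?thesis using L Q by (simp add: power_divide)
  qed
  define a1 where "a1 = (max a (1/2) + 1) / 2"
  have a1: "a < a1" "1/2 \<le> a1" "a1 < 1" using a by (auto simp: a1_def)
  have mono1: "a1 * \<psi>' a1 - Q / (1 - a1) \<le> r * \<psi>' r - Q / (1 - r)" if r: "a1 \<le> r" "r < 1" for r
  proof (rule DERIV_nonneg_imp_nondecreasing[OF r(1)])
    fix x assume x: "a1 \<le> x" "x \<le> r"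
    have "((\<lambda>r. Q / (1 - r)) has_real_derivative Q / (1 - x)\<^sup>2) (at x)"
      using x r by (auto intro!: derivative_eq_intros simp: power2_eq_square)
    from DERIV_diff[OF d2 this]
    have "((\<lambda>r. r * \<psi>' r - Q / (1 - r)) has_real_derivative
        x * laplacian \<phi> (of_real x) - Q / (1 - x)\<^sup>2) (at x)" using x r a1 by simp
    moreover have "Q / (1 - x)\<^sup>2 \<le> x * laplacian \<phi> (of_real x)"
    proof -
      have "Q / (1 - x)\<^sup>2 = 1/2 * (2 * Q / (1 - x)\<^sup>2)" by simp
      also have "\<dots> \<le> x * laplacian \<phi> (of_real x)"
        using lap[of x] x a1 r Q by (intro mult_mono) auto
      finally show ?thesis .
    qed
    ultimately show "\<exists>y. ((\<lambda>r. r * \<psi>' r - Q / (1 - r)) has_real_derivative y) (at x) \<and> 0 \<le> y"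
      by (metis diff_ge_0_iff_ge)
  qed
  define K where "K = \<bar>a1 * \<psi>' a1 - Q / (1 - a1)\<bar>"
  \<comment> \<open>From \<open>a2\<close> on, \<open>Q / 2 / (1 - r) \<ge> K + 1\<close>, which
    absorbs the integration constant; \<open>K + 1\<close> keeps the denominator positive when
    \<open>K = 0\<close>.\<close>
  define a2 where "a2 = max a1 (1 - Q / (2 * (K + 1)))"
  have K: "0 \<le> K" by (simp add: K_def)
  have a2: "a1 \<le> a2" "a2 < 1" using a1 Q K by (auto simp: a2_def)
  have \<psi>'_ge: "Q / 2 / (1 - r) \<le> \<psi>' r" if r: "a2 \<le> r" "r < 1" for r
  proof -
    have "1 - r \<le> Q / (2 * (K + 1))" using r by (auto simp: a2_def)
    then have "(1 - r) * (2 * (K + 1)) \<le> Q" using K by (simp add: pos_le_divide_eq)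
    then have "(K + 1) * (1 - r) \<le> Q / 2" by (simp add: algebra_simps)
    then have "K + 1 \<le> Q / 2 / (1 - r)" using r by (simp only: pos_le_divide_eq diff_gt_0_iff_gt)
    moreover have "- K \<le> r * \<psi>' r - Q / (1 - r)" using mono1[of r] r a2 by (auto simp: K_def)
    moreover have "Q / 2 / (1 - r) = Q / (1 - r) / 2"
      by (simp only: divide_divide_eq_left mult.commute)
    ultimately have *: "Q / 2 / (1 - r) \<le> r * \<psi>' r" by linarith
    moreover have "0 < Q / 2 / (1 - r)" using Q r by simp
    ultimately have "0 < r * \<psi>' r" by linarith
    then have "0 < \<psi>' r" using r a1 a2 by (simp add: zero_less_mult_iff)
    then have "r * \<psi>' r \<le> \<psi>' r" using r mult_right_mono[of r 1 "\<psi>' r"] by simp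
    with * show ?thesis by linarith
  qed
  have mono2: "\<phi> (of_real a2) + Q / 2 * ln (1 - a2) \<le> \<phi> (of_real r) + Q / 2 * ln (1 - r)"
    if r: "a2 \<le> r" "r < 1" for r
  proof (rule DERIV_nonneg_imp_nondecreasing[OF r(1)])
    fix x assume x: "a2 \<le> x" "x \<le> r"
    have "((\<lambda>r. q * ln (1 - r)) has_real_derivative - (q / (1 - x))) (at x)" for q
      using x r by (auto intro!: derivative_eq_intros)
    from DERIV_add[OF d1 this[of "Q / 2"]]
    have "((\<lambda>r. \<phi> (of_real r) + Q / 2 * ln (1 - r)) has_real_derivative
        \<psi>' x - Q / 2 / (1 - x)) (at x)" using x r a1 a2 by simp
    then show "\<exists>y. ((\<lambda>r. \<phi> (of_real r) + Q / 2 * ln (1 - r)) has_real_derivative y) (at x) \<and> 0 \<le> y"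
      using \<psi>'_ge[of x] x r by (intro exI[of _ "\<psi>' x - Q / 2 / (1 - x)"]) auto
  qed
  define L where "L = - (\<phi> (of_real a2) + Q / 2 * ln (1 - a2))"
  have near: "\<mu> (of_real r) \<le> exp L * (1 - r) ^ k" if r: "a2 \<le> r" "r < 1" for r
  proof -
    have r0: "0 < r" using r a1 a2 by simp
    have "- \<phi> (of_real r) \<le> L + Q / 2 * ln (1 - r)" using mono2[OF r] by (simp add: L_def)
    moreover have "Q / 2 * ln (1 - r) \<le> real k * ln (1 - r)"
      using r r0 by (intro mult_right_mono_neg) (auto simp: Q_def)
    ultimately have "exp (- \<phi> (of_real r)) \<le> exp (L + real k * ln (1 - r))" by simp
    also have "\<dots> = exp L * (1 - r) ^ k" using r by (simp add: exp_add exp_of_nat_mult)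
    finally show ?thesis using \<mu>[of "of_real r"] r r0 by simp
  qed
  have "continuous_on {0..a2} (\<lambda>r. \<mu> (of_real r))"
    by (rule continuous_on_compose2[OF cont]) (use a2 in \<open>auto intro!: continuous_intros\<close>)
  then have "bounded ((\<lambda>r. \<mu> (of_real r)) ` {0..a2})"
    by (intro compact_imp_bounded compact_continuous_image compact_Icc)
  then obtain K2 where "\<forall>y\<in>(\<lambda>r. \<mu> (of_real r)) ` {0..a2}. norm y \<le> K2"
    unfolding bounded_iff by blast
  then have K2: "\<mu> (of_real r) \<le> K2" if "r \<in> {0..a2}" for r
    using that abs_le_D1 by (metis image_eqI real_norm_def)
  define C where "C = max (exp L) (\<bar>K2\<bar> / (1 - a2) ^ k)"
  have "\<mu> (of_real r) \<le> C * (1 - r) ^ k" if r: "r \<in> {0..<1}" for r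
  proof (cases "a2 \<le> r")
    case True
    then have "\<mu> (of_real r) \<le> exp L * (1 - r) ^ k" using near r by simp
    also have "\<dots> \<le> C * (1 - r) ^ k" using r by (intro mult_right_mono) (auto simp: C_def)
    finally show ?thesis .
  next
    case False
    then have "\<mu> (of_real r) \<le> \<bar>K2\<bar> / (1 - a2) ^ k * (1 - a2) ^ k" using K2[of r] r a2 by auto
    also have "\<dots> \<le> C * (1 - r) ^ k"
      using r False a2 by (intro mult_mono power_mono) (auto simp: C_def le_max_iff_disj)
    finally show ?thesis .
  qed
  then show "\<exists>C. \<forall>r\<in>{0..<1}. \<mu> (of_real r) \<le> C * (1 - r) ^ k" by blast
qed

section \<open>Moments\<close>

text \<open>If the relative variances were bounded below, \<open>1 / (1 - \<rho> n)\<close> would grow at least linearly and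
  \<open>M\<close> would decay only polynomially.\<close>

lemma small_relative_variance:
  fixes M :: "nat \<Rightarrow> real"
  assumes pos: "\<And>n. 0 < M n" and dec: "\<And>n. M (Suc n) < M n"
    and decay: "\<And>k. \<exists>C. \<forall>n. real n ^ k * M n \<le> C"
    and "0 < \<epsilon>"
  defines "\<rho> \<equiv> \<lambda>n. M (Suc n) / M n"
  shows "\<exists>n\<ge>n0. \<rho> n * (\<rho> (Suc n) - \<rho> n) < \<epsilon> * (1 - \<rho> n)\<^sup>2"
proof (rule ccontr)
  assume "\<not> ?thesis"
  then have ge: "\<epsilon> * (1 - \<rho> n)\<^sup>2 \<le> \<rho> n * (\<rho> (Suc n) - \<rho> n)" if "n0 \<le> n" for n
    using that by force
  have \<rho>: "0 < \<rho> n" "\<rho> n < 1" for n using pos[of n] pos[of "Suc n"] dec[of n] by (auto simp: \<rho>_def)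
  \<comment> \<open>With \<open>x\<close> and \<open>y\<close> as below,
    \<open>1 / y - 1 / x = (x - y) / (x * y)\<close>; the negated claim gives
    \<open>x - y \<ge> \<epsilon> * x\<^sup>2\<close> and \<open>y < x\<close>.\<close>
  have step: "\<epsilon> + 1 / (1 - \<rho> n) \<le> 1 / (1 - \<rho> (Suc n))" if n: "n0 \<le> n" for n
  proof -
    define x y where "x = 1 - \<rho> n" and "y = 1 - \<rho> (Suc n)"
    have xy: "0 < x" "x < 1" "0 < y" using \<rho>[of n] \<rho>[of "Suc n"] by (auto simp: x_def y_def)
    have g: "\<epsilon> * x\<^sup>2 \<le> (1 - x) * (x - y)" using ge[OF n] by (simp add: x_def y_def algebra_simps)
    moreover have "0 < \<epsilon> * x\<^sup>2" using xy \<open>0 < \<epsilon>\<close> by simp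
    ultimately have "0 < (1 - x) * (x - y)" by linarith
    then have "y < x" using xy by (simp add: zero_less_mult_iff)
    then have "(1 - x) * (x - y) \<le> x - y" using xy mult_right_mono[of "1 - x" 1 "x - y"] by simp
    moreover have "\<epsilon> * (x * y) \<le> \<epsilon> * x\<^sup>2"
      using \<open>y < x\<close> xy \<open>0 < \<epsilon>\<close> by (simp add: power2_eq_square)
    ultimately have "\<epsilon> * (x * y) \<le> x - y" using g by linarith
    then have "\<epsilon> + 1 / x \<le> 1 / y" using xy by (simp add: field_simps)
    then show ?thesis by (simp add: x_def y_def)
  qed
  have lin: "\<epsilon> * real j < 1 / (1 - \<rho> (n0 + j))" for j
  proof (induction j)
    case 0
    then show ?case using \<rho>[of n0] by simp
  next
    case (Suc j)
    then show ?case using step[of "n0 + j"] by (simp add: algebra_simps)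
  qed
  obtain k :: nat where k: "1 / \<epsilon> < real k" using reals_Archimedean2 by blast
  \<comment> \<open>The shift by \<open>Suc k\<close> turns the linear growth into
    \<open>\<rho> (b + j) \<ge> (j + 1) / (j + 1 + k)\<close>, as \<open>1 / \<epsilon> < k\<close>.
    The product of these fractions telescopes to \<open>1 / ((j + k) choose k)\<close>, so
    \<open>M\<close> decays at most like the power \<open>-k\<close>, against which decay of order
    \<open>Suc k\<close> is played.\<close>
  define b where "b = n0 + Suc k"
  have below: "M b \<le> M (b + j) * real ((j + k) choose k)" for j
  proof (induction j)
    case 0
    then show ?case by simp
  next
    case (Suc j)
    have "\<epsilon> * real (Suc k + j) < 1 / (1 - \<rho> (b + j))"
      using lin[of "Suc k + j"] by (simp add: add_ac b_def)
    then have "(1 - \<rho> (b + j)) * (\<epsilon> * real (Suc k + j)) < 1"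
      using \<rho>[of "b + j"] by (simp add: pos_less_divide_eq mult.commute)
    then have "1 - \<rho> (b + j) < 1 / (\<epsilon> * real (Suc k + j))"
      using \<open>0 < \<epsilon>\<close> by (simp add: pos_less_divide_eq)
    also have "\<dots> = 1 / \<epsilon> / real (Suc k + j)" by simp
    also have "\<dots> \<le> real k / real (Suc k + j)" using k by (intro divide_right_mono) auto
    finally have "real (Suc j) \<le> \<rho> (b + j) * real (Suc j + k)" by (simp add: field_simps)
    then have "M (b + j) * real ((j + k) choose k) * real (Suc j)
        \<le> M (b + j) * real ((j + k) choose k) * (\<rho> (b + j) * real (Suc j + k))"
      using pos[of "b + j"] by (intro mult_left_mono) auto
    also have "\<dots> = M (b + j) * \<rho> (b + j) * real ((Suc j + k) * ((j + k) choose k))"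
      by (simp only: of_nat_mult mult_ac)
    also have "(Suc j + k) * ((j + k) choose k) = Suc j * ((Suc j + k) choose k)"
      using binomial_absorb_comp[of "Suc j + k" k] by simp
    also have "M (b + j) * \<rho> (b + j) = M (b + Suc j)" using pos[of "b + j"] by (simp add: \<rho>_def)
    finally have "M (b + j) * real ((j + k) choose k) \<le> M (b + Suc j) * real ((Suc j + k) choose k)"
      by (simp only: of_nat_mult mult.assoc mult.left_commute[of _ "real (Suc j)"]
          mult.commute[of _ "real (Suc j)"]) (simp only: mult_le_cancel_left_pos of_nat_0_less_iff zero_less_Suc)
    with Suc show ?case by linarith
  qed
  obtain C where C: "\<And>n. real n ^ Suc k * M n \<le> C" using decay by blast
  have "real j * M b \<le> C" for j
  proof -
    have "(j + k) choose k \<le> (j + k) ^ k" by (rule binomial_le_pow) simp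
    also have "\<dots> \<le> (b + j) ^ k" by (rule power_mono) (auto simp: b_def)
    finally have "real ((j + k) choose k) \<le> real (b + j) ^ k" 
      by (metis of_nat_le_iff of_nat_power)
    then have "M (b + j) * real ((j + k) choose k) \<le> M (b + j) * real (b + j) ^ k"
      using pos[of "b + j"] by (intro mult_left_mono) auto
    then have "M b \<le> M (b + j) * real (b + j) ^ k" using below[of j] by linarith
    then have "real j * M b \<le> real (b + j) * (M (b + j) * real (b + j) ^ k)"
      using pos[of b] by (intro mult_mono) auto
    also have "\<dots> \<le> C" using C[of "b + j"] by (simp add: mult_ac)
    finally show ?thesis .
  qed
  then have "real j \<le> C / M b" for j using pos[of b] by (simp add: pos_le_divide_eq)
  then show False using reals_Archimedean2[of "C / M b"] by (meson linorder_not_le)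
qed

section \<open>Moments of the radial measure and concentration at their mean\<close>

lemma power_le_exp:
  assumes "0 \<le> (y::real)"
  shows "y ^ k \<le> real k ^ k * exp y"
proof (cases "k = 0")
  case False
  have "y / real k \<le> exp (y / real k)" using exp_ge_add_one_self[of "y / real k"] by linarith
  then have "(y / real k) ^ k \<le> exp (y / real k) ^ k" using assms by (intro power_mono) auto
  also have "\<dots> = exp y" using False by (simp flip: exp_of_nat_mult)
  finally show ?thesis using False by (simp add: power_divide divide_simps mult.commute)
qed (use assms in simp)

text \<open>\<open>1 - r\<close> differs from \<open>e\<close> by at most \<open>e / 2\<close>, the
  deviation used in Chebyshev's inequality. For \<open>0 < e \<le> 1/3\<close> these radii lie in
  \<open>[1/2, 1)\<close>.\<close>

definition band :: "real \<Rightarrow> real set" where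
  "band e = {r. e / 2 \<le> 1 - r \<and> 1 - r \<le> 3 * e / 2}"

lemma band_borel [measurable]: "band e \<in> sets borel"
  unfolding band_def by measurable

text \<open>From here on only the radial profile of the weight is kept. The exponent
  \<open>k\<close> is free in \<open>decay\<close>, so that assumption holds for every
  power.\<close>

locale decaying_profile =
  fixes w :: "real \<Rightarrow> real"
  assumes continuous: "continuous_on {0..<1} w"
    and positive: "0 \<le> r \<Longrightarrow> r < 1 \<Longrightarrow> 0 < w r"
    and decay: "\<exists>C. \<forall>r\<in>{0..<1}. w r \<le> C * (1 - r) ^ k"
begin

text \<open>The factor \<open>r\<close> matches the radial integral of the \<open>L\<close> norm
  and, up to \<open>2 * pi\<close>, area in polar coordinates. The indicator extends the density by
  0, since nothing is assumed of \<open>w\<close> off \<open>[0, 1)\<close>.\<close>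

definition N :: "real measure" where
  "N = density lborel (\<lambda>r. ennreal (w r * r * indicator {0..<1} r))"

lemma sets_N [measurable_cong, simp]: "sets N = sets borel"
  by (simp add: N_def)

lemma space_N [simp]: "space N = UNIV"
  by (simp add: N_def)

lemma w_borel [measurable]: "(\<lambda>r. w r * indicator {0..<1} r) \<in> borel_measurable borel"
  using borel_measurable_continuous_on_indicator[OF _ continuous] by (simp add: mult.commute)

lemma density_borel [measurable]: "(\<lambda>r. w r * r * indicator {0..<1} r) \<in> borel_measurable borel"
proof -
  have "(\<lambda>r. (w r * indicator {0..<1} r) * r) \<in> borel_measurable borel" by measurable
  then show ?thesis by (simp add: mult_ac)
qed

lemma nn_integral_N:
  assumes [measurable]: "f \<in> borel_measurable borel" and "\<And>r. 0 \<le> r \<Longrightarrow> r < 1 \<Longrightarrow> 0 \<le> f r"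
  shows "(\<integral>\<^sup>+r. ennreal (f r) \<partial>N) = (\<integral>\<^sup>+r\<in>{0..<1}. ennreal (f r * w r * r) \<partial>lborel)"
proof -
  have "(\<integral>\<^sup>+r. ennreal (f r) \<partial>N) = (\<integral>\<^sup>+r. ennreal (w r * r * indicator {0..<1} r) * ennreal (f r) \<partial>lborel)"
    unfolding N_def by (rule nn_integral_density) measurable
  also have "\<dots> = (\<integral>\<^sup>+r\<in>{0..<1}. ennreal (f r * w r * r) \<partial>lborel)"
  proof (rule nn_integral_cong)
    fix r :: real
    have "ennreal (w r * r) * ennreal (f r) = ennreal (f r * w r * r)" if "0 \<le> r" "r < 1"
      using that assms(2)[of r] positive[of r] by (simp add: mult_ac flip: ennreal_mult)
    then show "ennreal (w r * r * indicator {0..<1} r) * ennreal (f r) =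
        ennreal (f r * w r * r) * indicator {0..<1} r"
      by (simp split: split_indicator)
  qed
  finally show ?thesis .
qed

lemma AE_N: "AE r in N. 0 < r \<and> r < 1"
  unfolding N_def
proof (subst AE_density, simp, rule AE_I2, intro impI)
  fix r assume "0 < ennreal (w r * r * indicator {0..<1} r)"
  then have "0 \<le> r" "r < 1" "r \<noteq> 0" by (auto split: split_indicator_asm)
  then show "0 < r \<and> r < 1" by simp
qed

lemma finite_measure_N: "finite_measure N"
proof
  have "\<exists>C. \<forall>r\<in>{0..<1}. w r \<le> C" using decay[of 0] by simp
  then obtain C where C: "\<And>r. r \<in> {0..<1} \<Longrightarrow> w r \<le> C" by blast
  have "emeasure N (space N) = (\<integral>\<^sup>+r. ennreal (w r * r * indicator {0..<1} r) \<partial>lborel)"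
    unfolding N_def by (subst emeasure_density) auto
  also have "\<dots> \<le> (\<integral>\<^sup>+r. ennreal C * indicator {0..1::real} r \<partial>lborel)"
  proof (rule nn_integral_mono)
    fix r :: real
    have "w r * r \<le> C" if "0 \<le> r" "r < 1"
      using C[of r] positive[of r] that mult_mono[of "w r" C r 1] by auto
    then show "ennreal (w r * r * indicator {0..<1} r) \<le> ennreal C * indicator {0..1} r"
      by (auto simp: indicator_def ennreal_leI)
  qed
  also have "\<dots> < \<infinity>" by (simp add: nn_integral_cmult_indicator ennreal_mult_less_top)
  finally show "emeasure N (space N) \<noteq> \<infinity>" by simp
qed

sublocale finite_measure N by (rule finite_measure_N)

lemma integrable_N:
  fixes f :: "real \<Rightarrow> real"
  assumes [measurable]: "f \<in> borel_measurable borel" and "\<And>r. 0 < r \<Longrightarrow> r < 1 \<Longrightarrow> \<bar>f r\<bar> \<le> b"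
  shows "integrable N f"
  by (rule integrable_const_bound[of _ b]) (use AE_N in eventually_elim, auto simp: assms(2))

text \<open>The density is positive on \<open>(0, 1)\<close>, so a vanishing integral would make the
  interval \<open>{max 0 a<..<1}\<close> a Lebesgue null set.\<close>

lemma integral_N_pos:
  fixes f :: "real \<Rightarrow> real"
  assumes f: "integrable N f" and nonneg: "\<And>r. 0 < r \<Longrightarrow> r < 1 \<Longrightarrow> 0 \<le> f r"
    and "a < 1" and pos: "\<And>r. 0 < r \<Longrightarrow> a < r \<Longrightarrow> r < 1 \<Longrightarrow> 0 < f r"
  shows "0 < (\<integral>r. f r \<partial>N)"
proof -
  have ae: "AE r in N. 0 \<le> f r" using AE_N by eventually_elim (simp add: nonneg)
  have "(\<integral>r. f r \<partial>N) \<noteq> 0"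
  proof
    assume "(\<integral>r. f r \<partial>N) = 0"
    then have "AE r in N. f r = 0" using integral_nonneg_eq_0_iff_AE[OF f ae] by simp
    then have "AE r in lborel. 0 < ennreal (w r * r * indicator {0..<1} r) \<longrightarrow> f r = 0"
      unfolding N_def by (subst (asm) AE_density) auto
    then have "AE r in lborel. r \<notin> {max 0 a<..<1::real}"
    proof eventually_elim
      case (elim r)
      show ?case
      proof
        assume r: "r \<in> {max 0 a<..<1}"
        then have "0 < w r * r * indicator {0..<1} r" using positive[of r] by simp
        then show False using elim pos[of r] r by auto
      qed
    qed
    then have "{max 0 a<..<1::real} \<in> null_sets lborel" by (subst (asm) AE_iff_null_sets[symmetric]) auto
    then show False using \<open>a < 1\<close> by (simp add: null_sets_def)
  qed
  then show ?thesis using integral_nonneg_AE[OF ae] by linarith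
qed

definition moment :: "nat \<Rightarrow> real" where
  "moment n = (\<integral>r. r ^ n \<partial>N)"

lemma integrable_power: "integrable N (\<lambda>r. r ^ n)"
  by (rule integrable_N[of _ 1]) (auto simp: power_le_one)

lemma moment_pos: "0 < moment n"
  unfolding moment_def by (rule integral_N_pos[of _ 0, OF integrable_power]) auto

lemma moment_less: "moment (Suc n) < moment n"
proof -
  have i: "integrable N (\<lambda>r. r ^ n - r ^ Suc n)"
    by (intro Bochner_Integration.integrable_diff integrable_power)
  have "0 < (\<integral>r. r ^ n - r ^ Suc n \<partial>N)"
    by (rule integral_N_pos[of _ 0, OF i]) (auto simp: power_Suc_le_self mult_less_cancel_right1)
  then show ?thesis
    unfolding moment_def by (subst (asm) Bochner_Integration.integral_diff) (simp_all only: integrable_power diff_gt_0_iff_gt)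
qed

text \<open>\<open>r ^ n \<le> exp (- (n * (1 - r)))\<close> and the decay of \<open>w\<close> of
  order \<open>k\<close> bound the integrand by \<open>C * y ^ k * exp (- y)\<close> with
  \<open>y = n * (1 - r)\<close>, hence by \<open>C * k ^ k\<close> uniformly in
  \<open>n\<close>.\<close>

lemma moment_decay: "\<exists>C. \<forall>n. real n ^ k * moment n \<le> C"
proof -
  obtain C where C: "\<And>r. r \<in> {0..<1} \<Longrightarrow> w r \<le> C * (1 - r) ^ k" using decay[of k] by blast
  have C0: "0 < C" using C[of 0] positive[of 0] by simp
  have "real n ^ k * moment n \<le> C * real k ^ k" for n
  proof -
    have "ennreal (real n ^ k * moment n) = ennreal (\<integral>r. real n ^ k * r ^ n \<partial>N)"
      by (simp add: moment_def)
    also have "\<dots> = (\<integral>\<^sup>+r. ennreal (real n ^ k * r ^ n) \<partial>N)"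
      by (rule nn_integral_eq_integral[symmetric])
        (use AE_N in \<open>auto intro!: integrable_power elim!: eventually_mono\<close>)
    also have "\<dots> = (\<integral>\<^sup>+r\<in>{0..<1}. ennreal (real n ^ k * r ^ n * w r * r) \<partial>lborel)"
      by (rule nn_integral_N) auto
    also have "\<dots> \<le> (\<integral>\<^sup>+r. ennreal (C * real k ^ k) * indicator {0..1::real} r \<partial>lborel)"
    proof (rule nn_integral_mono)
      fix r :: real
      have "real n ^ k * r ^ n * w r * r \<le> C * real k ^ k" if r: "0 \<le> r" "r < 1"
      proof -
        have "r \<le> exp (- (1 - r))" using exp_ge_add_one_self[of "- (1 - r)"] by simp
        then have "r ^ n \<le> exp (- (1 - r)) ^ n" using r by (intro power_mono) auto
        also have "\<dots> = exp (- (real n * (1 - r)))"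
          unfolding exp_of_nat_mult[symmetric] by (simp add: algebra_simps)
        finally have rn: "r ^ n \<le> exp (- (real n * (1 - r)))" .
        have "real n ^ k * r ^ n * w r * r \<le> real n ^ k * r ^ n * w r * 1"
          using r positive[OF r] by (intro mult_left_mono) auto
        also have "\<dots> \<le> real n ^ k * exp (- (real n * (1 - r))) * (C * (1 - r) ^ k)"
          unfolding mult_1_right using r positive[OF r] C[of r] rn by (intro mult_mono) auto
        also have "\<dots> = C * ((real n * (1 - r)) ^ k * exp (- (real n * (1 - r))))"
          by (simp add: power_mult_distrib)
        also have "\<dots> \<le> C * (real k ^ k * exp (real n * (1 - r)) * exp (- (real n * (1 - r))))"
          using C0 r by (intro mult_left_mono mult_right_mono power_le_exp) auto
        also have "\<dots> = C * real k ^ k" by (simp add: exp_minus)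
        finally show ?thesis .
      qed
      then show "ennreal (real n ^ k * r ^ n * w r * r) * indicator {0..<1} r
          \<le> ennreal (C * real k ^ k) * indicator {0..1} r"
        by (auto simp: indicator_def ennreal_leI)
    qed
    also have "\<dots> = ennreal (C * real k ^ k)" by (simp add: nn_integral_cmult_indicator)
    finally show ?thesis using C0 by (subst (asm) ennreal_le_iff) auto
  qed
  then show ?thesis by blast
qed

text \<open>\<open>N\<close> gives positive mass \<open>c\<close> to \<open>[R, 1)\<close>, where
  \<open>r ^ n \<ge> R ^ n\<close>. So the moments decay more slowly than every geometric
  sequence.\<close>

lemma moment_lower:
  assumes "0 < R" "R < 1"
  shows "\<exists>c>0. \<forall>n. c * R ^ n \<le> moment n"
proof -
  have i: "integrable N (indicator {R..} :: real \<Rightarrow> real)"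
    by (rule integrable_N[of _ 1]) auto
  have "0 < (\<integral>r. indicator {R..} r \<partial>N :: real)"
    by (rule integral_N_pos[OF i _ assms(2)]) auto
  moreover have "(\<integral>r. indicator {R..} r \<partial>N :: real) * R ^ n \<le> moment n" for n
  proof -
    have "(\<integral>r. indicator {R..} r \<partial>N :: real) * R ^ n = (\<integral>r. indicator {R..} r * R ^ n \<partial>N)" by simp
    also have "\<dots> \<le> moment n"
      unfolding moment_def
    proof (rule integral_mono_AE)
      show "integrable N (\<lambda>r. indicator {R..} r * R ^ n :: real)" using i by (rule integrable_mult_left)
      show "AE r in N. indicator {R..} r * R ^ n \<le> r ^ n"
        using AE_N by eventually_elim (use assms in \<open>auto simp: indicator_def intro: power_mono\<close>)
    qed (rule integrable_power)
    finally show ?thesis .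
  qed
  ultimately show ?thesis by blast
qed

text \<open>Under the probability measure \<open>r ^ n dN / moment n\<close> the mean of
  \<open>r\<close> is \<open>\<rho> n\<close> and that of \<open>r\<^sup>2\<close> is
  \<open>\<rho> n * \<rho> (Suc n)\<close>. This expresses the variance by consecutive ratios, as
  \<open>small_relative_variance\<close> demands.\<close>

lemma moment_variance:
  defines "\<rho> \<equiv> \<lambda>n. moment (Suc n) / moment n"
  shows "integrable N (\<lambda>r. r ^ n * (r - \<rho> n)\<^sup>2)"
    and "(\<integral>r. r ^ n * (r - \<rho> n)\<^sup>2 \<partial>N) = moment n * (\<rho> n * (\<rho> (Suc n) - \<rho> n))"
proof -
  have e: "r ^ n * (r - \<rho> n)\<^sup>2 = r ^ Suc (Suc n) - 2 * \<rho> n * r ^ Suc n + (\<rho> n)\<^sup>2 * r ^ n" for r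
    by (simp add: power2_eq_square algebra_simps)
  have i: "integrable N (\<lambda>r. r ^ Suc (Suc n))" "integrable N (\<lambda>r. 2 * \<rho> n * r ^ Suc n)"
    "integrable N (\<lambda>r. (\<rho> n)\<^sup>2 * r ^ n)"
    by (intro integrable_mult_right integrable_power)+
  show "integrable N (\<lambda>r. r ^ n * (r - \<rho> n)\<^sup>2)"
    unfolding e using i by (intro Bochner_Integration.integrable_diff Bochner_Integration.integrable_add)
  have "(\<integral>r. r ^ n * (r - \<rho> n)\<^sup>2 \<partial>N) =
      moment (Suc (Suc n)) - 2 * \<rho> n * moment (Suc n) + (\<rho> n)\<^sup>2 * moment n"
    unfolding e moment_def
    by (subst Bochner_Integration.integral_add Bochner_Integration.integral_diff;
        (intro Bochner_Integration.integrable_diff i)?)+ simp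
  also have "moment (Suc (Suc n)) = \<rho> (Suc n) * moment (Suc n)"
    using moment_pos[of "Suc n"] by (simp add: \<rho>_def)
  also have "moment (Suc n) = \<rho> n * moment n" using moment_pos[of n] by (simp add: \<rho>_def)
  finally show "(\<integral>r. r ^ n * (r - \<rho> n)\<^sup>2 \<partial>N) = moment n * (\<rho> n * (\<rho> (Suc n) - \<rho> n))"
    by (simp add: power2_eq_square algebra_simps)
qed

text \<open>Nonnegative variance makes the ratios increase. Were they all at most 2/3, the moments
  would be at most of order \<open>(2/3) ^ n\<close>, against a lower bound of order
  \<open>(3/4) ^ n\<close>. The threshold serves to obtain \<open>e \<le> 1/3\<close>.\<close>

lemma moment_ratio_eventually:
  "\<exists>n1. \<forall>n\<ge>n1. 2/3 < moment (Suc n) / moment n"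
proof -
  define \<rho> where "\<rho> n = moment (Suc n) / moment n" for n
  have \<rho>0: "0 < \<rho> n" for n using moment_pos[of n] moment_pos[of "Suc n"] by (simp add: \<rho>_def)
  have step: "\<rho> n \<le> \<rho> (Suc n)" for n
  proof -
    have "0 \<le> (\<integral>r. r ^ n * (r - \<rho> n)\<^sup>2 \<partial>N)"
      by (rule integral_nonneg_AE) (use AE_N in eventually_elim, auto)
    then have "0 \<le> moment n * (\<rho> n * (\<rho> (Suc n) - \<rho> n))"
      using moment_variance(2)[of n] by (simp add: \<rho>_def)
    then show ?thesis using moment_pos[of n] \<rho>0[of n] by (simp add: zero_le_mult_iff)
  qed
  have mono: "\<rho> m \<le> \<rho> n" if "m \<le> n" for m n using lift_Suc_mono_le[of \<rho>, OF step that] .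
  show ?thesis
  proof (cases "\<exists>n1. 2/3 < \<rho> n1")
    case True
    then obtain n1 where "2/3 < \<rho> n1" by blast
    then show ?thesis using mono[of n1] unfolding \<rho>_def by (meson less_le_trans)
  next
    case False
    then have le: "\<rho> n \<le> 2/3" for n by (simp add: not_less)
    have up: "moment n \<le> moment 0 * (2/3) ^ n" for n
    proof (induction n)
      case (Suc n)
      have "moment (Suc n) = \<rho> n * moment n" using moment_pos[of n] by (simp add: \<rho>_def)
      also have "\<dots> \<le> 2/3 * moment n" using le moment_pos[of n] by (intro mult_right_mono) auto
      finally show ?case using Suc by simp
    qed simp
    obtain c where c: "0 < c" "\<And>n. c * (3/4) ^ n \<le> moment n"
      using moment_lower[of "3/4"] by auto
    have "((\<lambda>n. moment 0 * (8/9) ^ n) \<longlonglongrightarrow> moment 0 * 0)"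
      by (intro tendsto_mult tendsto_const LIMSEQ_power_zero) auto
    then have "eventually (\<lambda>n. moment 0 * (8/9) ^ n < c) sequentially"
      using c(1) by (intro order_tendstoD(2)) auto
    then obtain n where n: "moment 0 * (8/9) ^ n < c" by (auto simp: eventually_sequentially)
    have "moment 0 * (2/3) ^ n = moment 0 * (8/9) ^ n * (3/4) ^ n"
      by (simp flip: power_mult_distrib add: mult.assoc)
    also have "\<dots> < c * (3/4) ^ n" using n by simp
    finally show ?thesis using up[of n] c(2)[of n] by linarith
  qed
qed

text \<open>Chebyshev's inequality for the normalised measure \<open>r ^ n dN\<close>, whose mean is \<open>1 - e\<close>.\<close>

lemma concentration:
  assumes "0 < \<epsilon>"
  shows "\<exists>n\<ge>n0. \<exists>e>0. e \<le> 1/3 \<and> (\<integral>r. r ^ n * indicator (- band e) r \<partial>N) \<le> \<epsilon> * moment n"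
proof -
  obtain n1 where n1: "\<And>n. n1 \<le> n \<Longrightarrow> 2/3 < moment (Suc n) / moment n"
    using moment_ratio_eventually by blast
  define \<rho> where "\<rho> n = moment (Suc n) / moment n" for n
  \<comment> \<open>\<open>\<epsilon> / 4\<close> prepays the factor \<open>4 / e\<^sup>2\<close> of
    Chebyshev's inequality with deviation \<open>e / 2\<close>.\<close>
  obtain n where n: "max n0 n1 \<le> n" "\<rho> n * (\<rho> (Suc n) - \<rho> n) < \<epsilon> / 4 * (1 - \<rho> n)\<^sup>2"
    using small_relative_variance[of moment "\<epsilon> / 4" "max n0 n1", OF moment_pos moment_less moment_decay]
      assms unfolding \<rho>_def by auto
  define e where "e = 1 - \<rho> n"
  have e: "0 < e" "e \<le> 1/3"
    using n1[of n] n(1) moment_less[of n] moment_pos[of n] by (auto simp: e_def \<rho>_def)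
  have "(\<integral>r. r ^ n * indicator (- band e) r \<partial>N) \<le> (\<integral>r. 4 / e\<^sup>2 * (r ^ n * (r - \<rho> n)\<^sup>2) \<partial>N)"
  proof (rule integral_mono_AE)
    show "integrable N (\<lambda>r. r ^ n * indicator (- band e) r)"
      by (rule integrable_N[of _ 1]) (auto simp: indicator_def power_le_one)
    show "integrable N (\<lambda>r. 4 / e\<^sup>2 * (r ^ n * (r - \<rho> n)\<^sup>2))"
      using moment_variance(1)[of n] by (intro integrable_mult_right) (simp add: \<rho>_def)
    show "AE r in N. r ^ n * indicator (- band e) r \<le> 4 / e\<^sup>2 * (r ^ n * (r - \<rho> n)\<^sup>2)"
      using AE_N
    proof eventually_elim
      case (elim r)
      show ?case
      proof (cases "r \<in> band e")
        case False
        then have "e / 2 \<le> \<bar>r - \<rho> n\<bar>" using e unfolding band_def e_def by (auto simp: abs_if field_simps)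
        then have "(e / 2)\<^sup>2 \<le> \<bar>r - \<rho> n\<bar>\<^sup>2" using e by (intro power_mono) auto
        then have "1 \<le> 4 / e\<^sup>2 * (r - \<rho> n)\<^sup>2" using e by (simp add: field_simps power_divide)
        then have "r ^ n * 1 \<le> r ^ n * (4 / e\<^sup>2 * (r - \<rho> n)\<^sup>2)"
          using elim by (intro mult_left_mono) auto
        then show ?thesis using False by (simp add: mult_ac)
      qed (use elim in auto)
    qed
  qed
  also have "\<dots> = 4 / e\<^sup>2 * (moment n * (\<rho> n * (\<rho> (Suc n) - \<rho> n)))"
    using moment_variance(2)[of n] by (simp add: \<rho>_def)
  also have "\<dots> \<le> 4 / e\<^sup>2 * (moment n * (\<epsilon> / 4 * e\<^sup>2))"
    using n(2) moment_pos[of n] by (intro mult_left_mono) (auto simp: e_def)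
  also have "\<dots> = \<epsilon> * moment n" using e by simp
  finally show ?thesis using n(1) e by auto
qed

end

section \<open>Integration over sectors\<close>

lemma Complex_measurable [measurable (raw)]:
  assumes "g \<in> borel_measurable M" "h \<in> borel_measurable M"
  shows "(\<lambda>x. Complex (g x) (h x)) \<in> borel_measurable M"
  using assms by (simp add: Complex_eq)

text \<open>Both measures agree on boxes. The product form gives access to Tonelli's theorem, and
  through it to invariance under shears, which translate each slice.\<close>

lemma lborel_complex_eq: "(lborel :: complex measure) = distr (lborel \<Otimes>\<^sub>M lborel) borel (\<lambda>p. Complex (fst p) (snd p))"
proof (rule lborel_eqI)
  fix l u :: complex assume le: "\<And>b. b \<in> Basis \<Longrightarrow> l \<bullet> b \<le> u \<bullet> b"
  then have le': "Re l \<le> Re u" "Im l \<le> Im u" 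
    using le[of 1] le[of \<i>] by (simp_all add: Basis_complex_def inner_complex_def)
  have m: "(\<lambda>p. Complex (fst p) (snd p)) \<in> borel_measurable (lborel \<Otimes>\<^sub>M lborel)"
    by measurable
  have "(\<lambda>p. Complex (fst p) (snd p)) -` box l u = {Re l<..<Re u} \<times> {Im l<..<Im u}"
    by (auto simp: in_box_complex_iff)
  then show "emeasure (distr (lborel \<Otimes>\<^sub>M lborel) borel (\<lambda>p. Complex (fst p) (snd p))) (box l u)
      = (\<Prod>b\<in>Basis. (u - l) \<bullet> b)"
    using le' by (simp add: emeasure_distr[OF m] space_pair_measure lborel.emeasure_pair_measure_Times
        Basis_complex_def inner_complex_def ennreal_mult)
qed simp

lemma nn_integral_lborel_complex:
  fixes f :: "complex \<Rightarrow> ennreal"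
  assumes [measurable]: "f \<in> borel_measurable borel"
  shows "(\<integral>\<^sup>+z. f z \<partial>lborel) = (\<integral>\<^sup>+y. \<integral>\<^sup>+x. f (Complex x y) \<partial>lborel \<partial>lborel)"
    and "(\<integral>\<^sup>+z. f z \<partial>lborel) = (\<integral>\<^sup>+x. \<integral>\<^sup>+y. f (Complex x y) \<partial>lborel \<partial>lborel)"
proof -
  have f: "(\<lambda>p. f (Complex (fst p) (snd p))) \<in> borel_measurable (lborel \<Otimes>\<^sub>M lborel)"
    by measurable
  then have f': "(\<lambda>(x, y). f (Complex x y)) \<in> borel_measurable (lborel \<Otimes>\<^sub>M lborel)"
    by (simp add: split_beta')
  have *: "(\<integral>\<^sup>+z. f z \<partial>lborel) = (\<integral>\<^sup>+p. f (Complex (fst p) (snd p)) \<partial>(lborel \<Otimes>\<^sub>M lborel))"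
    by (subst lborel_complex_eq) (simp add: nn_integral_distr)
  show "(\<integral>\<^sup>+z. f z \<partial>lborel) = (\<integral>\<^sup>+x. \<integral>\<^sup>+y. f (Complex x y) \<partial>lborel \<partial>lborel)"
    using * lborel.nn_integral_fst[OF f] by simp
  show "(\<integral>\<^sup>+z. f z \<partial>lborel) = (\<integral>\<^sup>+y. \<integral>\<^sup>+x. f (Complex x y) \<partial>lborel \<partial>lborel)"
    using * lborel_pair.nn_integral_snd[OF f'] by (simp add: split_beta')
qed

lemma nn_integral_lborel_translate:
  fixes f :: "real \<Rightarrow> ennreal"
  assumes "f \<in> borel_measurable borel"
  shows "(\<integral>\<^sup>+x. f (x + c) \<partial>lborel) = (\<integral>\<^sup>+x. f x \<partial>lborel)"
  using nn_integral_real_affine[OF assms, of 1 c] by (simp add: add.commute)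

lemma nn_integral_shear_Re:
  fixes f :: "complex \<Rightarrow> ennreal"
  assumes [measurable]: "f \<in> borel_measurable borel"
  shows "(\<integral>\<^sup>+z. f (Complex (Re z + c * Im z) (Im z)) \<partial>lborel) = (\<integral>\<^sup>+z. f z \<partial>lborel)"
proof -
  have "(\<integral>\<^sup>+x. f (Complex (x + c * y) y) \<partial>lborel) = (\<integral>\<^sup>+x. f (Complex x y) \<partial>lborel)" for y
    by (rule nn_integral_lborel_translate) simp
  then show ?thesis by (simp add: nn_integral_lborel_complex(1))
qed

lemma nn_integral_shear_Im:
  fixes f :: "complex \<Rightarrow> ennreal"
  assumes [measurable]: "f \<in> borel_measurable borel"
  shows "(\<integral>\<^sup>+z. f (Complex (Re z) (Im z + c * Re z)) \<partial>lborel) = (\<integral>\<^sup>+z. f z \<partial>lborel)"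
proof -
  have "(\<integral>\<^sup>+y. f (Complex x (y + c * x)) \<partial>lborel) = (\<integral>\<^sup>+y. f (Complex x y) \<partial>lborel)" for x
    by (rule nn_integral_lborel_translate) simp
  then show ?thesis by (simp add: nn_integral_lborel_complex(2))
qed

text \<open>A rotation by an angle different from \<open>\<pi>\<close> is a product of three shears.\<close>

lemma nn_integral_rotate_aux:
  fixes f :: "complex \<Rightarrow> ennreal"
  assumes f[measurable]: "f \<in> borel_measurable borel" and a: "cos (a / 2) \<noteq> 0"
  shows "(\<integral>\<^sup>+z. f (z * cis a) \<partial>lborel) = (\<integral>\<^sup>+z. f z \<partial>lborel)"
proof -
  define t where "t = tan (a / 2)"
  define g where "g z = f (Complex (Re z + (- t) * Im z) (Im z))" for z
  define h where "h z = g (Complex (Re z) (Im z + sin a * Re z))" for z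
  have g[measurable]: "g \<in> borel_measurable borel" unfolding g_def[abs_def] by measurable
  have h[measurable]: "h \<in> borel_measurable borel" unfolding h_def[abs_def] by measurable
  have s: "sin a = 2 * sin (a / 2) * cos (a / 2)" using sin_double[of "a / 2"] by simp
  \<comment> \<open>The half-angle identities \<open>c\<close> and \<open>st\<close> say that the
    shears with parameters \<open>- t\<close>, \<open>sin a\<close>, \<open>- t\<close> compose to
    the rotation by \<open>a\<close>.\<close>
  have c: "cos a = 1 - sin a * t"
    using cos_double_sin[of "a / 2"] a by (simp add: s t_def tan_def power2_eq_square)
  have st: "t * (1 + cos a) = sin a"
    using cos_double_cos[of "a / 2"] a by (simp add: s t_def tan_def power2_eq_square)
  have "f (z * cis a) = h (Complex (Re z + (- t) * Im z) (Im z))" for z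
  proof -
    have im: "Im z + sin a * (Re z + - t * Im z) = Re z * sin a + Im z * cos a"
      by (simp add: c algebra_simps)
    have "Re z + - t * Im z + - t * (Re z * sin a + Im z * cos a) =
        Re z * (1 - sin a * t) - Im z * (t * (1 + cos a))"
      by (simp add: algebra_simps)
    also have "\<dots> = Re z * cos a - Im z * sin a" by (simp only: st c [symmetric])
    finally show ?thesis unfolding h_def g_def complex.sel im
      by (intro arg_cong[of _ _ f]) (simp add: complex_eq_iff)
  qed
  then have "(\<integral>\<^sup>+z. f (z * cis a) \<partial>lborel) = (\<integral>\<^sup>+z. h z \<partial>lborel)"
    using nn_integral_shear_Re[OF h, of "- t"] by simp
  also have "\<dots> = (\<integral>\<^sup>+z. g z \<partial>lborel)"
    unfolding h_def by (rule nn_integral_shear_Im[OF g])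
  also have "\<dots> = (\<integral>\<^sup>+z. f z \<partial>lborel)"
    unfolding g_def by (rule nn_integral_shear_Re[OF f])
  finally show ?thesis .
qed

text \<open>An angle with \<open>cos (a / 2) = 0\<close> has no half-angle tangent, but
  \<open>cos (a / 4)\<close> is then nonzero, and two rotations by \<open>a / 2\<close> compose to
  the one wanted.\<close>

lemma nn_integral_rotate:
  fixes f :: "complex \<Rightarrow> ennreal"
  assumes f[measurable]: "f \<in> borel_measurable borel"
  shows "(\<integral>\<^sup>+z. f (z * cis a) \<partial>lborel) = (\<integral>\<^sup>+z. f z \<partial>lborel)"
proof (cases "cos (a / 2) = 0")
  case True
  have n: "cos (a / 2 / 2) \<noteq> 0" using cos_double_cos[of "a / 2 / 2"] True by auto
  have "(\<integral>\<^sup>+z. f (z * cis a) \<partial>lborel) = (\<integral>\<^sup>+z. f (z * cis (a / 2) * cis (a / 2)) \<partial>lborel)"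
    by (simp add: mult.assoc cis_mult)
  also have "\<dots> = (\<integral>\<^sup>+z. f (z * cis (a / 2)) \<partial>lborel)"
    by (rule nn_integral_rotate_aux[of "\<lambda>z. f (z * cis (a / 2))", OF _ n]) simp
  also have "\<dots> = (\<integral>\<^sup>+z. f z \<partial>lborel)" by (rule nn_integral_rotate_aux[OF f n])
  finally show ?thesis .
qed (rule nn_integral_rotate_aux[OF f])

text \<open>For \<open>0 \<le> \<alpha> \<le> pi\<close> this is the closed sector of half-angle
  \<open>\<alpha>\<close> about the direction \<open>t\<close>, vertex included. Written with a real
  part instead of \<open>Arg\<close>, the condition is closed, hence Borel, and has no branch
  cut.\<close>

definition sector :: "real \<Rightarrow> real \<Rightarrow> complex set" where
  "sector t \<alpha> = {z. norm z * cos \<alpha> \<le> Re (z * cis (- t))}"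

lemma sector_borel [measurable]: "sector t \<alpha> \<in> sets borel"
  unfolding sector_def by (intro borel_closed closed_Collect_le continuous_intros)

lemma polar_in_sector_iff:
  assumes "0 < r"
  shows "of_real r * cis s \<in> sector t \<alpha> \<longleftrightarrow> cos \<alpha> \<le> cos (s - t)"
proof -
  have "of_real r * cis s * cis (- t) = of_real r * cis (s - t)"
    by (simp add: mult.assoc cis_mult)
  then have "Re (of_real r * cis s * cis (- t)) = r * cos (s - t)" by (simp only:) simp
  with assms show ?thesis by (simp only: sector_def mem_Collect_eq) (simp add: norm_mult)
qed

lemma ex_near_multiple:
  fixes s :: real and k :: nat
  assumes "0 < k"
  obtains j :: int where "\<bar>s - 2 * pi * j / k\<bar> \<le> pi / k"
proof -
  define x where "x = s * k / (2 * pi)"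
  have "\<bar>x - round x\<bar> \<le> 1 / 2" using of_int_round_abs_le[of x] by (simp add: abs_minus_commute)
  then have "\<bar>x - round x\<bar> * (2 * pi / k) \<le> 1 / 2 * (2 * pi / k)" by (intro mult_right_mono) auto
  moreover have "s - 2 * pi * round x / k = (x - round x) * (2 * pi / k)"
    using assms by (simp add: x_def field_simps)
  ultimately have "\<bar>s - 2 * pi * round x / k\<bar> \<le> pi / k" by (simp add: abs_mult)
  then show thesis by (rule that)
qed

lemma cos_plus_two_pi_int: "cos (x + 2 * pi * real_of_int d) = cos x"
  using cos.plus_of_int[of x d] by (simp add: mult.commute)

lemma sectors_cover:
  assumes "0 < k"
  shows "\<exists>j<k. z \<in> sector (t + 2 * pi * real j / real k) (pi / real k)"
proof (cases "z = 0")
  case True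
  then show ?thesis using assms by (auto simp: sector_def)
next
  case False
  obtain j :: int where j: "\<bar>Arg z - t - 2 * pi * j / k\<bar> \<le> pi / k"
    using ex_near_multiple[OF assms] by blast
  define i where "i = nat (j mod int k)"
  have ik: "i < k" using assms by (simp add: i_def nat_less_iff)
  define d where "d = j div int k"
  have "j = int i + int k * d" using assms by (simp add: i_def d_def)
  then have jd: "real_of_int j = real i + real k * real_of_int d" by simp
  have "2 * pi * j / k = 2 * pi * real i / k + 2 * pi * d"
    unfolding jd using assms by (simp add: field_simps)
  then have eq: "Arg z - (t + 2 * pi * real i / k) = (Arg z - t - 2 * pi * j / k) + 2 * pi * d"
    by simp
  have "cos (pi / k) \<le> cos \<bar>Arg z - t - 2 * pi * j / k\<bar>"
    using assms j by (intro cos_monotone_0_pi_le) (auto simp: field_simps)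
  then have "cos (pi / k) \<le> cos (Arg z - (t + 2 * pi * real i / k))"
    unfolding eq cos_plus_two_pi_int by simp
  then have "of_real (norm z) * cis (Arg z) \<in> sector (t + 2 * pi * real i / real k) (pi / real k)"
    using False by (subst polar_in_sector_iff) auto
  moreover have "of_real (norm z) * cis (Arg z) = z"
    using rcis_cmod_Arg[of z] by (simp add: rcis_def)
  ultimately show ?thesis using ik by auto
qed

text \<open>The \<open>k\<close> rotated copies of the sector cover the plane and carry equal
  integrals; overlaps only enlarge their sum.\<close>

lemma nn_integral_sector_ge:
  fixes G :: "real \<Rightarrow> ennreal"
  assumes [measurable]: "G \<in> borel_measurable borel" and "0 < k"
  shows "(\<integral>\<^sup>+z. G (norm (z :: complex)) \<partial>lborel) \<le>
    of_nat k * (\<integral>\<^sup>+z. G (norm z) * indicator (sector t (pi / real k)) z \<partial>lborel)"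
proof -
  let ?S = "\<lambda>j::nat. sector (t + 2 * pi * real j / real k) (pi / real k)"
  have eq: "(\<integral>\<^sup>+z. G (norm z) * indicator (?S j) z \<partial>lborel) =
      (\<integral>\<^sup>+z. G (norm z) * indicator (sector t (pi / real k)) z \<partial>lborel)" for j
  proof -
    let ?b = "2 * pi * real j / real k"
    have "z * cis ?b \<in> ?S j \<longleftrightarrow> z \<in> sector t (pi / real k)" for z
    proof -
      have "z * cis ?b * cis (- (t + ?b)) = z * cis (- t)" by (simp add: mult.assoc cis_mult)
      then show ?thesis by (simp only: sector_def mem_Collect_eq norm_mult norm_cis mult_1_right)
    qed
    then have "indicator (?S j) (z * cis ?b) = (indicator (sector t (pi / real k)) z :: ennreal)" for z
      by (simp add: indicator_def)
    with nn_integral_rotate[of "\<lambda>z. G (norm z) * indicator (?S j) z" ?b]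
    show ?thesis by (simp add: norm_mult)
  qed
  have "(\<integral>\<^sup>+z. G (norm (z :: complex)) \<partial>lborel) \<le> (\<integral>\<^sup>+z. (\<Sum>j<k. G (norm z) * indicator (?S j) z) \<partial>lborel)"
  proof (rule nn_integral_mono)
    fix z :: complex
    obtain j where "j < k" "z \<in> ?S j" using sectors_cover[OF \<open>0 < k\<close>] by blast
    then have "G (norm z) = (\<Sum>j\<in>{j}. G (norm z) * indicator (?S j) z)" by simp
    also have "\<dots> \<le> (\<Sum>j<k. G (norm z) * indicator (?S j) z)"
      using \<open>j < k\<close> by (intro sum_mono2) auto
    finally show "G (norm z) \<le> (\<Sum>j<k. G (norm z) * indicator (?S j) z)" .
  qed
  also have "\<dots> = (\<Sum>j<k. \<integral>\<^sup>+z. G (norm z) * indicator (?S j) z \<partial>lborel)"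
    by (rule nn_integral_sum) simp
  also have "\<dots> = of_nat k * (\<integral>\<^sup>+z. G (norm z) * indicator (sector t (pi / real k)) z \<partial>lborel)"
    by (simp add: eq)
  finally show ?thesis .
qed

text \<open>The distribution of \<open>norm\<close> on the disc and \<open>2 * pi * r dr\<close>
  both give \<open>pi * (1 - x\<^sup>2)\<close> to the half line above
  \<open>x \<in> [0, 1)\<close>, and half lines determine a finite measure.\<close>

lemma nn_integral_radial:
  fixes G :: "real \<Rightarrow> ennreal"
  assumes [measurable]: "G \<in> borel_measurable borel"
  shows "(\<integral>\<^sup>+z\<in>unit_disc. G (norm z) \<partial>lborel) =
    (\<integral>\<^sup>+r\<in>{0..<1}. ennreal (2 * pi * r) * G r \<partial>lborel)"
proof -
  let ?M = "distr (density lborel (indicator unit_disc)) borel (norm :: complex \<Rightarrow> real)"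
  have [measurable]: "(indicator unit_disc :: complex \<Rightarrow> ennreal) \<in> borel_measurable borel"
    by (intro borel_measurable_indicator) simp
  let ?N = "density lborel (\<lambda>r. ennreal (2 * pi * r) * indicator {0..<1} r)"
  have M: "emeasure ?M {x<..} = ennreal (pi * (1 - (max 0 x)\<^sup>2)) * indicator {..<1} x" for x
  proof -
    have m: "{z::complex. x < norm z} \<in> sets borel" by measurable
    have "emeasure ?M {x<..} = emeasure (density lborel (indicator unit_disc)) {z::complex. x < norm z}"
      by (subst emeasure_distr) (auto simp: vimage_def)
    also have "\<dots> = emeasure lborel (unit_disc \<inter> {z. x < norm z})"
      using m by (subst emeasure_density) (auto simp flip: indicator_inter_arith)
    also have "unit_disc \<inter> {z. x < norm z} = unit_disc - cball (0::complex) x" by auto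
    also have "emeasure lborel \<dots> = ennreal (pi * (1 - (max 0 x)\<^sup>2)) * indicator {..<1} x"
    proof -
      consider "x < 0" | "0 \<le> x" "x < 1" | "1 \<le> x" by linarith
      then show ?thesis
      proof cases
        case 1
        then have "cball (0::complex) x = {}" by auto
        then show ?thesis using 1 by (simp add: emeasure_ball unit_ball_vol_2)
      next
        case 2
        have "emeasure lborel (unit_disc - cball (0::complex) x) =
            emeasure lborel unit_disc - emeasure lborel (cball (0::complex) x)"
          using 2 by (intro emeasure_Diff) (auto simp: emeasure_cball)
        also have "\<dots> = ennreal (pi * (1 - x\<^sup>2))"
          using 2 by (simp add: emeasure_ball emeasure_cball unit_ball_vol_2 ennreal_minus algebra_simps)
        finally show ?thesis using 2 by simp
      next
        case 3
        then have empty: "unit_disc - cball (0::complex) x = {}" by auto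
        show ?thesis unfolding empty using 3 by simp
      qed
    qed
    finally show ?thesis .
  qed
  have N: "emeasure ?N {x<..} = ennreal (pi * (1 - (max 0 x)\<^sup>2)) * indicator {..<1} x" for x
  proof -
    have "emeasure ?N {x<..} = (\<integral>\<^sup>+r. ennreal (2 * pi * r) * indicator {0..<1} r * indicator {x<..} r \<partial>lborel)"
      by (subst emeasure_density) auto
    also have "\<dots> = (\<integral>\<^sup>+r. ennreal (2 * pi * r) * indicator {max 0 x..1} r \<partial>lborel)"
    proof (rule nn_integral_cong_AE)
      have "AE r in lborel. r \<noteq> x" "AE r in lborel. r \<noteq> (1::real)"
        by (rule AE_lborel_singleton)+
      then show "AE r in lborel. ennreal (2 * pi * r) * indicator {0..<1} r * indicator {x<..} r =
          ennreal (2 * pi * r) * indicator {max 0 x..1} r"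
        by eventually_elim (auto simp: indicator_def)
    qed
    also have "\<dots> = ennreal (pi * (1 - (max 0 x)\<^sup>2)) * indicator {..<1} x"
    proof (cases "x < 1")
      case True
      have "(\<integral>\<^sup>+r. ennreal (2 * pi * r) * indicator {max 0 x..1} r \<partial>lborel) =
          ennreal (pi * 1\<^sup>2 - pi * (max 0 x)\<^sup>2)"
        using True
        by (intro nn_integral_FTC_Icc[where F = "\<lambda>r. pi * r\<^sup>2"])
          (auto intro!: derivative_eq_intros)
      then show ?thesis using True by (simp add: algebra_simps)
    next
      case False
      have "AE r in lborel. r \<noteq> (1::real)" by (rule AE_lborel_singleton)
      then have "AE r in lborel. ennreal (2 * pi * r) * indicator {max 0 x..1} r = 0"
        by eventually_elim (use False in \<open>auto simp: indicator_def\<close>)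
      then have "(\<integral>\<^sup>+r. ennreal (2 * pi * r) * indicator {max 0 x..1} r \<partial>lborel) = 0"
        by (subst nn_integral_0_iff_AE) auto
      then show ?thesis using False by simp
    qed
    finally show ?thesis .
  qed
  have "?M = ?N"
    by (rule measure_eqI_lessThan) (simp_all add: M N split: split_indicator)
  then have "(\<integral>\<^sup>+r. G r \<partial>?M) = (\<integral>\<^sup>+r. G r \<partial>?N)" by simp
  then show ?thesis
    by (simp add: nn_integral_distr nn_integral_density mult_ac)
qed

section \<open>Test functions\<close>

lemma one_minus_cos_le: "1 - cos x \<le> x\<^sup>2 / (2::real)"
proof -
  have "(sin (x / 2))\<^sup>2 \<le> (x / 2)\<^sup>2"
    using abs_sin_x_le_abs_x[of "x / 2"] by (simp only: abs_le_square_iff)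
  then show ?thesis using cos_double_sin[of "x / 2"] by (simp add: power_divide)
qed

text \<open>\<open>sin y \<ge> y / 2\<close> up to \<open>y = 1/2\<close>, because
  \<open>cos y \<ge> 1/2\<close> there; insert this with \<open>y = x / 2\<close> into
  \<open>cos x = 1 - 2 * (sin (x / 2))\<^sup>2\<close>.\<close>

lemma cos_le_quadratic:
  assumes "0 \<le> x" "x \<le> (1::real)"
  shows "cos x \<le> 1 - x\<^sup>2 / 8"
proof -
  have "sin 0 - 0 / 2 \<le> sin (x / 2) - x / 2 / 2"
  proof (rule DERIV_nonneg_imp_nondecreasing[where f = "\<lambda>x. sin x - x / 2" and a = 0 and b = "x / 2"])
    fix y assume y: "0 \<le> y" "y \<le> x / 2"
    have "cos (pi / 3) \<le> cos y" using y assms pi_gt3 by (intro cos_monotone_0_pi_le) auto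
    then show "\<exists>d. ((\<lambda>x. sin x - x / 2) has_real_derivative d) (at y) \<and> 0 \<le> d"
      by (intro exI[of _ "cos y - 1/2"]) (auto intro!: derivative_eq_intros simp: cos_60)
  qed (use assms in simp)
  then have "(x / 4)\<^sup>2 \<le> (sin (x / 2))\<^sup>2" using assms by (intro power_mono) auto
  then show ?thesis using cos_double_sin[of "x / 2"] by (simp add: power_divide)
qed

lemma sector_polar:
  assumes "z \<in> sector t \<alpha>" "z \<noteq> 0" "0 \<le> \<alpha>" "\<alpha> \<le> pi"
  obtains u where "\<bar>u\<bar> \<le> \<alpha>" "z = of_real (norm z) * cis (t + u)"
proof -
  define u where "u = Arg (z * cis (- t))"
  have "z * cis (- t) = of_real (norm z) * cis u"
    using rcis_cmod_Arg[of "z * cis (- t)"] by (simp add: rcis_def u_def norm_mult)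
  then have "z * cis (- t) * cis t = of_real (norm z) * cis (t + u)"
    by (simp add: cis_mult mult.assoc add.commute)
  then have z: "z = of_real (norm z) * cis (t + u)" by (simp add: mult.assoc cis_mult)
  have "of_real (norm z) * cis (t + u) \<in> sector t \<alpha>" using assms(1) z by simp
  then have "cos \<alpha> \<le> cos u" using assms(2) by (subst (asm) polar_in_sector_iff) auto
  then have "cos \<alpha> \<le> cos \<bar>u\<bar>" by simp
  then have "\<bar>u\<bar> \<le> \<alpha>"
    using Arg_bounded[of "z * cis (- t)"] assms by (subst (asm) cos_mono_le_eq) (auto simp: u_def)
  then show thesis using z by (rule that)
qed

text \<open>A point of the sector has angular distance at most
  \<open>pi / m + pi / (4 * m) = 5 * pi / (4 * m) < 4 / m \<le> e / 2\<close> from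
  \<open>\<theta>\<close>, and \<open>e / 2 \<le> 1 - norm z\<close> on the band; this dictates
  \<open>8 \<le> m * e\<close>. The ball records that the set stays away from the circle, for the
  gliding hump.\<close>

lemma sector_band_subset_tent:
  fixes m k :: nat and j :: int and e \<theta> :: real
  assumes m: "0 < m" "4 * m \<le> k" and e: "0 < e" "e \<le> 1/3" "8 \<le> m * e"
    and near: "\<bar>\<theta> - 2 * pi * j / m\<bar> \<le> pi / m"
  shows "sector (2 * pi * j / m) (pi / k) \<inter> norm -` band e \<subseteq> tent_region (cis \<theta>) \<inter> cball 0 (1 - e / 2)"
proof
  fix z :: complex assume z: "z \<in> sector (2 * pi * j / m) (pi / k) \<inter> norm -` band e"
  have k: "0 < k" using m by linarith
  have r: "e / 2 \<le> 1 - norm z" "1 - norm z \<le> 3 * e / 2" using z by (auto simp: band_def)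
  have "0 < norm z" using r e by linarith
  then have z0: "z \<noteq> 0" by auto
  have "pi / k \<le> pi" using k by (simp add: field_simps)
  then obtain u where u: "\<bar>u\<bar> \<le> pi / k" "z = of_real (norm z) * cis (2 * pi * j / m + u)"
    using sector_polar[of z "2 * pi * j / m" "pi / k"] z z0 by auto
  have "pi / k \<le> pi / (4 * m)" using m k by (intro divide_left_mono) (auto simp flip: of_nat_mult)
  then have "\<bar>2 * pi * j / m + u - \<theta>\<bar> \<le> pi / m + pi / (4 * m)" using u(1) near by linarith
  also have "\<dots> = 5 / 4 * pi / m" using m by (simp add: field_simps)
  also have "\<dots> < 4 / m" using m pi_approx by (intro divide_strict_right_mono) auto
  also have "\<dots> \<le> e / 2" using m e by (simp add: field_simps)
  also have "\<dots> \<le> norm (cis \<theta>) - norm z" using r by simp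
  finally have "\<bar>2 * pi * j / m + u - \<theta>\<bar> < norm (cis \<theta>) - norm z" .
  moreover have "is_Arg z (2 * pi * j / m + u)" using u(2) by (simp add: is_Arg_def cis_conv_exp)
  moreover have "is_Arg (cis \<theta>) \<theta>" by (simp add: is_Arg_def cis_conv_exp)
  moreover have "z \<in> unit_disc" using r e by simp
  ultimately show "z \<in> tent_region (cis \<theta>) \<inter> cball 0 (1 - e / 2)"
    using r unfolding tent_region_def by auto
qed

definition peak :: "real \<Rightarrow> nat \<Rightarrow> real \<Rightarrow> nat \<Rightarrow> complex \<Rightarrow> complex" where
  "peak c n A m z = of_real c * z ^ n * exp (of_real A * z ^ m)"

lemma peak_holomorphic: "peak c n A m holomorphic_on S"
  unfolding peak_def by (intro holomorphic_intros)

lemma norm_peak_polar: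
  assumes "0 \<le> c" "0 \<le> r"
  shows "norm (peak c n A m (of_real r * cis s)) = c * r ^ n * exp (A * r ^ m * cos (m * s))"
proof -
  have pow: "(complex_of_real r * cis s) ^ i = of_real (r ^ i) * cis (real i * s)" for i
    by (simp only: power_mult_distrib of_real_power Complex.DeMoivre)
  show ?thesis
    unfolding peak_def pow using assms by (simp add: norm_mult norm_power mult.assoc)
qed

lemma norm_peak_le:
  assumes "0 \<le> c" "0 \<le> A" "norm z \<le> 1"
  shows "norm (peak c n A m z) \<le> c * norm z ^ n * exp A"
proof -
  have "Re (of_real A * z ^ m) \<le> norm (of_real A * z ^ m)" by (rule complex_Re_le_cmod)
  also have "\<dots> \<le> A" using assms by (simp add: norm_mult norm_power mult_left_le power_le_one)
  finally show ?thesis using assms unfolding peak_def by (simp add: norm_mult norm_power mult_left_mono)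
qed

text \<open>On the band \<open>r \<ge> 1 - 3 * e / 2 \<ge> exp (- (3 * e))\<close>, and
  \<open>3 * m * e \<le> 27\<close>. Hence the factor \<open>A * r ^ m\<close> in the exponent of a
  peak stays comparable to \<open>A\<close> on the relevant circles.\<close>

lemma power_band_lower:
  fixes m :: nat and e r :: real
  assumes "0 < e" "e \<le> 1/3" "m * e \<le> 9" "r \<in> band e"
  shows "exp (- 27) \<le> r ^ m"
proof -
  define x where "x = 3 * e / 2"
  have x: "0 \<le> x" "x \<le> 1/2" using assms by (auto simp: x_def)
  have "2 * x\<^sup>2 \<le> x" using x mult_left_mono[of x "1/2" x] by (simp add: power2_eq_square)
  then have "- (2 * x) \<le> ln (1 - x)" using ln_one_minus_pos_lower_bound[OF x] by linarith
  then have "exp (- (2 * x)) \<le> 1 - x" using x by (simp add: ln_ge_iff)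
  also have "\<dots> \<le> r" using assms by (simp add: band_def x_def)
  finally have r: "exp (- (2 * x)) \<le> r" .
  have "- 27 \<le> real m * (- (2 * x))" using assms by (simp add: x_def mult_ac)
  then have "exp (- 27) \<le> exp (real m * (- (2 * x)))" by simp
  also have "\<dots> = exp (- (2 * x)) ^ m" by (rule exp_of_nat_mult)
  also have "\<dots> \<le> r ^ m" using r by (intro power_mono) auto
  finally show ?thesis .
qed

text \<open>\<open>S\<close> surrounds the maxima of \<open>cos (m * \<theta>)\<close> in
  \<open>[0, 2 * pi]\<close>. There are \<open>m + 1\<close> of them, both end points included, and
  \<open>(m + 1) * 2 * \<delta> / m \<le> 4 * \<delta>\<close>.\<close>

lemma peak_angles:
  fixes m :: nat and \<delta> :: real
  assumes "0 < m" "0 < \<delta>" "\<delta> \<le> 1"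
  defines "S \<equiv> \<Union>j\<in>{..m}. cball (2 * pi * real j / m) (\<delta> / m)"
  shows "S \<in> sets borel" and "emeasure lborel S \<le> ennreal (4 * \<delta>)"
    and "\<And>\<theta>. \<theta> \<in> {0..2 * pi} \<Longrightarrow> \<theta> \<notin> S \<Longrightarrow> cos (real m * \<theta>) \<le> 1 - \<delta>\<^sup>2 / 8"
proof -
  show "S \<in> sets borel" unfolding S_def by (intro sets.finite_UN) auto
  have "emeasure lborel S \<le> (\<Sum>j\<in>{..m}. emeasure lborel (cball (2 * pi * real j / m) (\<delta> / m)))"
    unfolding S_def by (rule emeasure_subadditive_finite) auto
  also have "\<dots> = ennreal ((real m + 1) * (2 * \<delta> / m))"
    using assms by (simp add: cball_eq_atLeastAtMost ennreal_of_nat_eq_real_of_nat flip: ennreal_mult ennreal_plus)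
  also have "\<dots> \<le> ennreal (4 * \<delta>)" using assms by (intro ennreal_leI) (simp add: field_simps)
  finally show "emeasure lborel S \<le> ennreal (4 * \<delta>)" .
  fix \<theta> :: real assume \<theta>: "\<theta> \<in> {0..2 * pi}" "\<theta> \<notin> S"
  obtain j :: int where j: "\<bar>\<theta> - 2 * pi * j / m\<bar> \<le> pi / m"
    using ex_near_multiple[OF assms(1)] by blast
  then have "\<bar>\<theta> - 2 * pi * j / m\<bar> * m \<le> pi" using assms by (simp add: field_simps)
  moreover have eq: "\<bar>\<theta> - 2 * pi * j / m\<bar> * m = \<bar>m * \<theta> - 2 * pi * j\<bar>"
  proof -
    have "(\<theta> - 2 * pi * j / m) * m = m * \<theta> - 2 * pi * j" using assms by (simp add: field_simps)
    then show ?thesis by (metis abs_mult abs_of_nat)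
  qed
  ultimately have jm: "\<bar>m * \<theta> - 2 * pi * j\<bar> \<le> pi" by simp
  have "0 \<le> m * \<theta>" "m * \<theta> \<le> m * (2 * pi)" using \<theta> by (auto intro: mult_left_mono)
  \<comment> \<open>The nearest maximum must be one of the centres of \<open>S\<close>:
    \<open>j\<close> lies between \<open>- 1/2\<close> and \<open>m + 1/2\<close>, and it is an
    integer.\<close>
  then have "- pi \<le> 2 * pi * j" "2 * pi * j \<le> m * (2 * pi) + pi" using jm by linarith+
  then have "pi * (- 1) \<le> pi * (2 * j)" "pi * (2 * j) \<le> pi * (2 * m + 1)" by (auto simp: algebra_simps)
  then have "- 1 \<le> 2 * real_of_int j" "2 * real_of_int j \<le> 2 * real m + 1"
    by (simp_all only: mult_le_cancel_left_pos[OF pi_gt_zero])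
  then have j01: "0 \<le> j" "j \<le> int m" by linarith+
  then have "cball (2 * pi * real (nat j) / m) (\<delta> / m) \<subseteq> S" unfolding S_def by (intro UN_upper) auto
  then have "\<theta> \<notin> cball (2 * pi * real (nat j) / m) (\<delta> / m)" using \<theta>(2) by blast
  then have "\<delta> / m < \<bar>\<theta> - 2 * pi * j / m\<bar>" using j01 by (simp add: dist_real_def abs_minus_commute)
  then have "\<delta> < \<bar>\<theta> - 2 * pi * j / m\<bar> * m" using assms by (simp add: field_simps)
  then have v: "\<delta> < \<bar>m * \<theta> - 2 * pi * j\<bar>" by (simp only: eq)
  have "cos (m * \<theta>) = cos (m * \<theta> - 2 * pi * j)"
    using cos_plus_two_pi_int[of "m * \<theta> - 2 * pi * j" j] by simp
  also have "\<dots> = cos \<bar>m * \<theta> - 2 * pi * j\<bar>" by simp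
  also have "\<dots> \<le> cos \<delta>" using v jm assms by (intro cos_monotone_0_pi_le) auto
  also have "\<dots> \<le> 1 - \<delta>\<^sup>2 / 8" using assms by (intro cos_le_quadratic) auto
  finally show "cos (real m * \<theta>) \<le> 1 - \<delta>\<^sup>2 / 8" .
qed

section \<open>Radial and sectorial integrals of a peak\<close>

context decaying_profile
begin

text \<open>The part over the band of the radial integral of a peak with \<open>c = 1\<close>, taken
  in a direction where the cosine is 1.\<close>

definition peak_mass :: "nat \<Rightarrow> real \<Rightarrow> nat \<Rightarrow> real \<Rightarrow> real" where
  "peak_mass n A m e = (\<integral>r. r ^ n * exp (A * r ^ m) * indicator (band e) r \<partial>N)"

lemma peak_mass_integrable:
  assumes "0 \<le> A"
  shows "integrable N (\<lambda>r. r ^ n * exp (A * r ^ m) * indicator (band e) r)"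
proof (rule integrable_N[of _ "exp A"])
  fix r :: real assume r: "0 < r" "r < 1"
  have "r ^ n * exp (A * r ^ m) \<le> 1 * exp A"
    using r assms by (intro mult_mono) (auto simp: power_le_one mult_left_le)
  then show "\<bar>r ^ n * exp (A * r ^ m) * indicator (band e) r\<bar> \<le> exp A"
    using r by (auto simp: indicator_def abs_mult)
qed measurable

lemma integrable_power_indicator:
  assumes [measurable]: "B \<in> sets borel"
  shows "integrable N (\<lambda>r. r ^ n * indicator B r)"
  by (rule integrable_N[of _ 1]) (auto simp: indicator_def power_le_one)

lemma moment_le_peak_mass:
  assumes "0 \<le> A" and out: "(\<integral>r. r ^ n * indicator (- band e) r \<partial>N) \<le> moment n / 2"
  shows "moment n \<le> 2 * peak_mass n A m e"
proof -
  have "moment n = (\<integral>r. r ^ n * indicator (band e) r + r ^ n * indicator (- band e) r \<partial>N)"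
    unfolding moment_def by (intro Bochner_Integration.integral_cong) (auto simp: indicator_def)
  also have "\<dots> = (\<integral>r. r ^ n * indicator (band e) r \<partial>N) + (\<integral>r. r ^ n * indicator (- band e) r \<partial>N)"
    by (intro Bochner_Integration.integral_add integrable_power_indicator) auto
  finally have "moment n / 2 \<le> (\<integral>r. r ^ n * indicator (band e) r \<partial>N)" using out by simp
  also have "\<dots> \<le> peak_mass n A m e"
    unfolding peak_mass_def
  proof (rule integral_mono_AE)
    show "AE r in N. r ^ n * indicator (band e) r \<le> r ^ n * exp (A * r ^ m) * indicator (band e) r"
      using AE_N
    proof eventually_elim
      case (elim r)
      then have "r ^ n * 1 \<le> r ^ n * exp (A * r ^ m)" using assms by (intro mult_left_mono) auto
      then show ?case by (simp split: split_indicator)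
    qed
  qed (use assms in \<open>auto intro: integrable_power_indicator peak_mass_integrable\<close>)
  finally show ?thesis by simp
qed

text \<open>\<open>q\<close> is the attenuation relative to a peak direction on the band; off the
  band the crude factor \<open>exp A\<close> is paid for by the small mass \<open>\<eta>\<close>.
  The lemma serves with attenuation 1 near the peaks and an exponentially small one
  elsewhere.\<close>

lemma radial_integral_le:
  assumes "0 \<le> c" "0 \<le> A" "0 \<le> q" "x \<le> 1"
    and out: "(\<integral>r. r ^ n * indicator (- band e) r \<partial>N) \<le> \<eta>"
    and q: "\<And>r. r \<in> band e \<Longrightarrow> 0 < r \<Longrightarrow> r < 1 \<Longrightarrow> exp (A * r ^ m * x) \<le> q * exp (A * r ^ m)"
  shows "(\<integral>\<^sup>+r\<in>{0..<1}. ennreal (c * r ^ n * exp (A * r ^ m * x) * w r * r) \<partial>lborel)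
      \<le> ennreal (c * (q * peak_mass n A m e + exp A * \<eta>))"
proof -
  let ?f = "\<lambda>r. c * q * (r ^ n * exp (A * r ^ m) * indicator (band e) r) + c * exp A * (r ^ n * indicator (- band e) r)"
  have i1: "integrable N (\<lambda>r. c * q * (r ^ n * exp (A * r ^ m) * indicator (band e) r))"
    using assms by (intro integrable_mult_right peak_mass_integrable)
  have i2: "integrable N (\<lambda>r. c * exp A * (r ^ n * indicator (- band e) r))"
    by (intro integrable_mult_right integrable_power_indicator) auto
  have "(\<integral>\<^sup>+r\<in>{0..<1}. ennreal (c * r ^ n * exp (A * r ^ m * x) * w r * r) \<partial>lborel)
      = (\<integral>\<^sup>+r. ennreal (c * r ^ n * exp (A * r ^ m * x)) \<partial>N)"
    using assms by (subst nn_integral_N) auto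
  also have "\<dots> \<le> (\<integral>\<^sup>+r. ennreal (?f r) \<partial>N)"
  proof (rule nn_integral_mono_AE)
    show "AE r in N. ennreal (c * r ^ n * exp (A * r ^ m * x)) \<le> ennreal (?f r)"
      using AE_N
    proof eventually_elim
      case (elim r)
      show ?case
      proof (rule ennreal_leI, cases "r \<in> band e")
        case True
        have "c * r ^ n * exp (A * r ^ m * x) \<le> c * r ^ n * (q * exp (A * r ^ m))"
          using q[OF True] elim assms by (intro mult_left_mono) auto
        then show "c * r ^ n * exp (A * r ^ m * x) \<le> ?f r" using True by (simp add: mult_ac)
      next
        case False
        have "r ^ m * x \<le> r ^ m * 1" using elim assms by (intro mult_left_mono) auto
        moreover have "r ^ m \<le> 1" using elim by (intro power_le_one) auto
        ultimately have "A * (r ^ m * x) \<le> A * 1" using assms by (intro mult_left_mono) auto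
        then have "c * r ^ n * exp (A * r ^ m * x) \<le> c * r ^ n * exp A"
          using elim assms by (intro mult_left_mono) (auto simp: mult.assoc)
        then show "c * r ^ n * exp (A * r ^ m * x) \<le> ?f r" using False by (simp add: mult_ac)
      qed
    qed
  qed
  also have "\<dots> = ennreal (\<integral>r. ?f r \<partial>N)"
  proof (rule nn_integral_eq_integral)
    show "AE r in N. 0 \<le> ?f r" using AE_N by eventually_elim (use assms in auto)
  qed (intro Bochner_Integration.integrable_add i1 i2)
  also have "(\<integral>r. ?f r \<partial>N) =
      c * q * peak_mass n A m e + c * exp A * (\<integral>r. r ^ n * indicator (- band e) r \<partial>N)"
    unfolding peak_mass_def by (subst Bochner_Integration.integral_add[OF i1 i2]) simp
  also have "\<dots> \<le> c * q * peak_mass n A m e + c * exp A * \<eta>"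
    using out assms(1) by (intro add_left_mono mult_left_mono) auto
  also have "\<dots> = c * (q * peak_mass n A m e + exp A * \<eta>)" by (simp add: algebra_simps)
  finally show ?thesis by (simp add: ennreal_leI)
qed

text \<open>The last hypothesis makes \<open>t\<close> a peak direction. Within
  \<open>pi / k\<close> of it the exponent drops by at most
  \<open>A * (m * pi / k)\<^sup>2 / 2 \<le> 1/2\<close>, so the modulus keeps at least half its peak
  value. This bound is radial, and a sector receives at least the \<open>k\<close>-th part of a
  radial integral.\<close>

lemma sector_integral_ge:
  fixes m k :: nat and t e :: real
  assumes c: "0 \<le> c" and A: "0 \<le> A" and k: "0 < k" and e: "0 < e" "e \<le> 1/3"
    and phase: "A * (m * pi / k)\<^sup>2 \<le> 1" and t: "\<And>u :: real. cos (m * (t + u)) = cos (m * u)"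
  shows "ennreal (c * peak_mass n A m e * (2 * pi / (3 * e * k))) \<le>
    (\<integral>\<^sup>+z\<in>sector t (pi / k) \<inter> norm -` band e.
       ennreal (norm (peak c n A m z) * w (norm z) / (1 - norm z)) \<partial>lborel)"
proof -
  \<comment> \<open>\<open>1 / (3 * e)\<close> is \<open>1/2\<close>, for the loss in modulus, times
    \<open>2 / (3 * e)\<close>, the least value of \<open>1 / (1 - r)\<close> on the band.\<close>
  define g where "g r = c * (r ^ n * exp (A * r ^ m)) * (1 / (3 * e))" for r
  define G where "G r = ennreal (g r * (w r * indicator {0..<1} r) * indicator (band e) r)" for r
  have [measurable]: "G \<in> borel_measurable borel"
    unfolding G_def g_def by measurable
  have g0: "0 \<le> g r" if "0 \<le> r" for r using that c e by (simp add: g_def)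
  have half: "1/2 \<le> exp (- (1/2) :: real)" using exp_ge_add_one_self[of "- (1/2) :: real"] by simp
  have bnd: "r < 1" "0 < r" if "r \<in> band e" for r using that e by (auto simp: band_def)
  have "ennreal (c * peak_mass n A m e * (2 * pi / (3 * e)))
      = (\<integral>\<^sup>+r. ennreal (2 * pi * c * (1 / (3 * e)) * (r ^ n * exp (A * r ^ m) * indicator (band e) r)) \<partial>N)"
  proof (subst nn_integral_eq_integral)
    show "AE r in N. 0 \<le> 2 * pi * c * (1 / (3 * e)) * (r ^ n * exp (A * r ^ m) * indicator (band e) r)"
      using AE_N by eventually_elim (use c e in auto)
    show "integrable N (\<lambda>r. 2 * pi * c * (1 / (3 * e)) * (r ^ n * exp (A * r ^ m) * indicator (band e) r))"
      using A by (intro integrable_mult_right peak_mass_integrable)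
  qed (simp add: peak_mass_def mult_ac)
  also have "\<dots> = (\<integral>\<^sup>+r\<in>{0..<1}. ennreal (2 * pi * c * (1 / (3 * e)) *
      (r ^ n * exp (A * r ^ m) * indicator (band e) r) * w r * r) \<partial>lborel)"
    by (rule nn_integral_N) (use c e in auto)
  also have "\<dots> = (\<integral>\<^sup>+r\<in>{0..<1}. ennreal (2 * pi * r) * G r \<partial>lborel)"
  proof (rule nn_integral_cong)
    fix r :: real
    have "ennreal (2 * pi * r) * G r = ennreal (2 * pi * c * (1 / (3 * e)) *
      (r ^ n * exp (A * r ^ m) * indicator (band e) r) * w r * r)" if "0 \<le> r" "r < 1"
      using that g0[of r] positive[of r] unfolding G_def
      by (subst ennreal_mult'[symmetric]) (auto simp: g_def mult_ac split: split_indicator)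
    then show "ennreal (2 * pi * c * (1 / (3 * e)) *
      (r ^ n * exp (A * r ^ m) * indicator (band e) r) * w r * r) * indicator {0..<1} r =
        ennreal (2 * pi * r) * G r * indicator {0..<1} r"
      by (simp split: split_indicator)
  qed
  also have "\<dots> = (\<integral>\<^sup>+z\<in>unit_disc. G (norm z) \<partial>lborel)"
    by (rule nn_integral_radial[symmetric]) simp
  also have "\<dots> = (\<integral>\<^sup>+z. G (norm (z :: complex)) \<partial>lborel)"
    by (rule nn_integral_cong) (auto simp: G_def split: split_indicator)
  also have "\<dots> \<le> of_nat k * (\<integral>\<^sup>+z. G (norm z) * indicator (sector t (pi / k)) z \<partial>lborel)"
    by (rule nn_integral_sector_ge[OF _ k]) simp
  also have "(\<integral>\<^sup>+z. G (norm z) * indicator (sector t (pi / k)) z \<partial>lborel) \<le>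
    (\<integral>\<^sup>+z\<in>sector t (pi / k) \<inter> norm -` band e.
       ennreal (norm (peak c n A m z) * w (norm z) / (1 - norm z)) \<partial>lborel)"
  proof (rule nn_integral_mono)
    fix z :: complex
    show "G (norm z) * indicator (sector t (pi / k)) z \<le>
        ennreal (norm (peak c n A m z) * w (norm z) / (1 - norm z)) *
        indicator (sector t (pi / k) \<inter> norm -` band e) z"
    proof (cases "z \<in> sector t (pi / k) \<and> norm z \<in> band e")
      case True
      define r where "r = norm z"
      have r: "0 < r" "r < 1" "r \<in> band e" using True bnd[of "norm z"] by (auto simp: r_def)
      have "z \<noteq> 0" using r(1) unfolding r_def by auto
      moreover have "pi / k \<le> pi" using k by (simp add: field_simps)
      ultimately obtain u where u: "\<bar>u\<bar> \<le> pi / k" "z = of_real r * cis (t + u)"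
        using sector_polar[of z t "pi / k"] True unfolding r_def by auto
      have "\<bar>m * u\<bar> \<le> m * pi / k" using u(1) mult_left_mono[of "\<bar>u\<bar>" "pi / k" m] by (simp add: abs_mult)
      then have "(m * u)\<^sup>2 \<le> (m * pi / k)\<^sup>2" using power_mono[of "\<bar>m * u\<bar>" "m * pi / k" 2] by simp
      then have "A * (m * u)\<^sup>2 \<le> 1" using A phase mult_left_mono[of "(m * u)\<^sup>2" "(m * pi / k)\<^sup>2" A] by linarith
      moreover have "A * (1 - cos (m * u)) \<le> A * ((m * u)\<^sup>2 / 2)"
        using A one_minus_cos_le by (rule mult_left_mono[rotated])
      ultimately have "A * (1 - cos (m * u)) \<le> 1/2" by simp
      moreover have "r ^ m * (A * (1 - cos (m * u))) \<le> A * (1 - cos (m * u))"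
        using r A by (intro mult_left_le_one_le) (auto simp: power_le_one)
      ultimately have "A * r ^ m + - (1/2) \<le> A * r ^ m * cos (m * u)" by (simp add: algebra_simps)
      then have "exp (A * r ^ m + - (1/2)) \<le> exp (A * r ^ m * cos (m * u))" by simp
      then have "exp (A * r ^ m) * exp (- (1/2)) \<le> exp (A * r ^ m * cos (m * u))" by (simp only: exp_add)
      moreover have "exp (A * r ^ m) * (1/2) \<le> exp (A * r ^ m) * exp (- (1/2))"
        using half by (intro mult_left_mono) auto
      ultimately have ex: "exp (A * r ^ m) * (1/2) \<le> exp (A * r ^ m * cos (m * u))" by linarith
      have "norm (peak c n A m z) = c * r ^ n * exp (A * r ^ m * cos (m * u))"
        using norm_peak_polar[OF c, of r n A m "t + u"] r u(2) t by simp
      then have "c * r ^ n * (exp (A * r ^ m) * (1/2)) \<le> norm (peak c n A m z)"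
        using ex c r by (simp only:) (intro mult_left_mono, auto)
      moreover have "2 / (3 * e) \<le> 1 / (1 - r)"
        using r e by (simp add: band_def field_simps)
      ultimately have "c * r ^ n * (exp (A * r ^ m) * (1/2)) * (2 / (3 * e)) \<le>
          norm (peak c n A m z) * (1 / (1 - r))"
        using c e r by (intro mult_mono) auto
      then have "g r \<le> norm (peak c n A m z) / (1 - r)" by (simp add: g_def mult_ac)
      then have "g r * w r \<le> norm (peak c n A m z) / (1 - r) * w r"
        using positive[of r] r by (intro mult_right_mono) auto
      then show ?thesis using True r by (simp add: G_def flip: r_def) (simp add: ennreal_leI mult_ac)
    qed (auto simp: G_def split: split_indicator)
  qed
  finally have "ennreal (c * peak_mass n A m e * (2 * pi / (3 * e))) \<le> of_nat k *
    (\<integral>\<^sup>+z\<in>sector t (pi / k) \<inter> norm -` band e.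
       ennreal (norm (peak c n A m z) * w (norm z) / (1 - norm z)) \<partial>lborel)"
    by (simp add: mult_left_mono)
  then have "ennreal (1 / k) * ennreal (c * peak_mass n A m e * (2 * pi / (3 * e))) \<le>
    ennreal (1 / k) * (of_nat k *
    (\<integral>\<^sup>+z\<in>sector t (pi / k) \<inter> norm -` band e.
       ennreal (norm (peak c n A m z) * w (norm z) / (1 - norm z)) \<partial>lborel))"
    by (rule mult_left_mono) simp
  moreover have "ennreal (1 / k) * (of_nat k * X) = X" for X
    using k by (simp add: mult.assoc[symmetric] ennreal_of_nat_eq_real_of_nat flip: ennreal_mult)
  moreover have "ennreal (1 / k) * ennreal (c * peak_mass n A m e * (2 * pi / (3 * e))) =
      ennreal (c * peak_mass n A m e * (2 * pi / (3 * e * k)))"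
    using k by (simp add: ennreal_mult'[symmetric] mult_ac)
  ultimately show ?thesis by simp
qed

text \<open>Compare with the lower bound \<open>c * R' ^ n\<close> for a ratio \<open>R'\<close>
  between \<open>R\<close> and 1. This makes a peak normalised by its moment negligible on a fixed
  smaller disc.\<close>

lemma power_over_moment_tendsto_0:
  assumes "0 < R" "R < 1"
  shows "(\<lambda>n. R ^ n / moment n) \<longlonglongrightarrow> 0"
proof -
  define R' where "R' = (1 + R) / 2"
  have R': "0 < R'" "R' < 1" "R < R'" using assms by (auto simp: R'_def)
  obtain c where c: "0 < c" "\<And>n. c * R' ^ n \<le> moment n" using moment_lower[OF R'(1,2)] by blast
  have "(\<lambda>n. 1 / c * (R / R') ^ n) \<longlonglongrightarrow> 1 / c * 0"
    using assms R' by (intro tendsto_mult tendsto_const LIMSEQ_power_zero) auto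
  then have lim: "(\<lambda>n. 1 / c * (R / R') ^ n) \<longlonglongrightarrow> 0" by simp
  show ?thesis
  proof (rule tendsto_sandwich[OF _ _ tendsto_const lim])
    show "eventually (\<lambda>n. 0 \<le> R ^ n / moment n) sequentially"
      using assms moment_pos by (intro always_eventually allI divide_nonneg_pos) auto
    show "eventually (\<lambda>n. R ^ n / moment n \<le> 1 / c * (R / R') ^ n) sequentially"
    proof (intro always_eventually allI)
      fix n
      have "R ^ n / moment n \<le> R ^ n / (c * R' ^ n)"
        using assms R' c moment_pos[of n] by (intro divide_left_mono) auto
      then show "R ^ n / moment n \<le> 1 / c * (R / R') ^ n" by (simp add: power_divide)
    qed
  qed
qed

text \<open>\<open>u\<close> majorises the square root of the inner integral, as suits
  \<open>q / p = 1/2\<close>, and such majorants add up under summation of functions. Passing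
  through \<open>u\<close> avoids the question whether the inner integral is measurable in
  \<open>\<theta>\<close>.\<close>

definition radially_small :: "real \<Rightarrow> (complex \<Rightarrow> complex) \<Rightarrow> bool" where
  "radially_small \<epsilon> h \<longleftrightarrow> (\<exists>u\<in>borel_measurable borel. (\<forall>\<theta>. 0 \<le> u \<theta>) \<and>
      (\<forall>\<theta>\<in>{0..2 * pi}. (\<integral>\<^sup>+r\<in>{0..<1}. ennreal (norm (h (of_real r * cis \<theta>)) * w r * r) \<partial>lborel) \<le> ennreal ((u \<theta>)\<^sup>2)) \<and>
      (\<integral>\<^sup>+\<theta>\<in>{0..2 * pi}. ennreal (u \<theta>) \<partial>lborel) \<le> ennreal \<epsilon>)"

text \<open>The lower bound sits on a Borel subset of the cone, which avoids measurability of the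
  cone itself. Since \<open>W\<close> lies in \<open>cball 0 R\<close>, later humps can be made
  small on it.\<close>

definition tent_large :: "real \<Rightarrow> real \<Rightarrow> (complex \<Rightarrow> complex) \<Rightarrow> bool" where
  "tent_large K R h \<longleftrightarrow> (\<forall>\<theta>. \<exists>W\<in>sets borel. W \<subseteq> tent_region (cis \<theta>) \<inter> cball 0 R \<and>
      ennreal K \<le> (\<integral>\<^sup>+z\<in>W. ennreal (norm (h z) * w (norm z) / (1 - norm z)) \<partial>lborel))"

lemma tent_large_mono:
  assumes "tent_large K R h" "R \<le> R'"
  shows "tent_large K R' h"
  unfolding tent_large_def
proof
  fix \<theta>
  obtain W where "W \<in> sets borel" "W \<subseteq> tent_region (cis \<theta>) \<inter> cball 0 R"
    "ennreal K \<le> (\<integral>\<^sup>+z\<in>W. ennreal (norm (h z) * w (norm z) / (1 - norm z)) \<partial>lborel)"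
    using assms(1) unfolding tent_large_def by blast
  moreover have "cball 0 R \<subseteq> cball (0::complex) R'" using assms(2) by auto
  ultimately show "\<exists>W\<in>sets borel. W \<subseteq> tent_region (cis \<theta>) \<inter> cball 0 R' \<and>
      ennreal K \<le> (\<integral>\<^sup>+z\<in>W. ennreal (norm (h z) * w (norm z) / (1 - norm z)) \<partial>lborel)"
    by (intro bexI[of _ W] conjI) blast+
qed

text \<open>\<open>\<epsilon>\<close> and \<open>K\<close> are independent of each other, so the
  tent norm with exponents 1 and 1/2 admits no estimate by the radial one. The bounds on the disc
  and on \<open>cball 0 R\<close> are there for the later summation.\<close>

lemma test_function:
  assumes "0 < \<epsilon>" "0 < R" "R < 1" "0 < K"
  shows "\<exists>h. h holomorphic_on UNIV \<and> (\<exists>G. \<forall>z\<in>unit_disc. norm (h z) \<le> G) \<and> (\<forall>z\<in>cball 0 R. norm (h z) \<le> \<epsilon>) \<and>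
    radially_small \<epsilon> h \<and> (\<exists>R'<1. tent_large K R' h)"
proof -
  define \<kappa> :: real where "\<kappa> = exp (- 27)"
  have \<kappa>: "0 < \<kappa>" by (simp add: \<kappa>_def)
  \<comment> \<open>With \<open>2 * X = 40 * K * b ^ 6\<close>, the first term is the cost of the
    directions near peaks, of order \<open>1 / b\<close>, and the second that of all other
    directions.\<close>
  have "((\<lambda>b::real. sqrt (40 * K * b ^ 6) * (4 / b ^ 4) +
      2 * pi * sqrt (40 * K * b ^ 6 * exp (- (\<kappa> * b ^ 4 / 8)))) \<longlongrightarrow> 0) at_top"
    using \<open>0 < K\<close> \<kappa> by real_asymp
  from filterlim_compose[OF this filterlim_real_sequentially]
  have "eventually (\<lambda>b::nat. sqrt (40 * K * real b ^ 6) * (4 / real b ^ 4) +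
      2 * pi * sqrt (40 * K * real b ^ 6 * exp (- (\<kappa> * real b ^ 4 / 8))) < \<epsilon>) sequentially"
    using \<open>0 < \<epsilon>\<close> by (rule order_tendstoD(2))
  then obtain b0 where b0: "\<And>b. b0 \<le> b \<Longrightarrow> sqrt (40 * K * real b ^ 6) * (4 / real b ^ 4) +
      2 * pi * sqrt (40 * K * real b ^ 6 * exp (- (\<kappa> * real b ^ 4 / 8))) < \<epsilon>"
    by (auto simp: eventually_sequentially)
  define b where "b = max b0 1"
  have b: "0 < b" "1 \<le> real b" by (auto simp: b_def)
  txt \<open>The powers of \<open>b\<close> are chosen so that a peak of width \<open>A powr (-1/2) = b powr -6\<close> of height \<open>X\<close> makes
    the integral over every cone of order \<open>K\<close>, while \<open>sqrt X * \<delta>\<close> is still small and \<open>A * \<delta>\<^sup>2\<close> is large.\<close>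
  define \<delta> A q X \<eta> where "\<delta> = 1 / real b ^ 4" and "A = real b ^ 12" and "q = exp (- (\<kappa> * real b ^ 4 / 8))"
    and "X = 20 * K * real b ^ 6" and "\<eta> = q / (2 * exp A)"
  have \<delta>: "0 < \<delta>" "\<delta> \<le> 1" using b by (auto simp: \<delta>_def)
  have A: "0 \<le> A" by (simp add: A_def)
  have q: "0 < q" "q \<le> 1" using \<kappa> by (auto simp: q_def)
  have X: "0 < X" using b \<open>0 < K\<close> by (simp add: X_def)
  have small: "sqrt (2 * X) * (4 * \<delta>) + 2 * pi * sqrt (2 * X * q) < \<epsilon>"
    using b0[of b] by (simp add: b_def X_def \<delta>_def q_def mult.assoc)
  have "q * 1 \<le> 1 * exp A" using q A by (intro mult_mono) auto
  then have \<eta>: "0 < \<eta>" "\<eta> \<le> 1/2" using q by (auto simp: \<eta>_def field_simps)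
  have "(\<lambda>n. 2 * X * exp A * (R ^ n / moment n)) \<longlonglongrightarrow> 2 * X * exp A * 0"
    using assms by (intro tendsto_mult tendsto_const power_over_moment_tendsto_0)
  then have "eventually (\<lambda>n. 2 * X * exp A * (R ^ n / moment n) < \<epsilon>) sequentially"
    using \<open>0 < \<epsilon>\<close> by (intro order_tendstoD(2)) auto
  then obtain n0 where n0: "\<And>n. n0 \<le> n \<Longrightarrow> 2 * X * exp A * (R ^ n / moment n) < \<epsilon>"
    by (auto simp: eventually_sequentially)
  \<comment> \<open>\<open>\<eta>\<close> contains \<open>1 / exp A\<close>, so the mass outside the
    band, even amplified by \<open>exp A\<close>, stays below \<open>q * E\<close>. Concentration is
    thus demanded after \<open>A\<close> is fixed; it yields the scale \<open>e\<close> to which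
    \<open>m\<close> is adapted.\<close>
  obtain n e where n: "n0 \<le> n" and e: "0 < e" "e \<le> 1/3"
    and out: "(\<integral>r. r ^ n * indicator (- band e) r \<partial>N) \<le> \<eta> * moment n"
    using concentration[OF \<eta>(1), of n0] by blast
  \<comment> \<open>The least integer with \<open>m * e \<ge> 8\<close>, so that every cone contains
    a peak; \<open>m * e \<le> 8 + e \<le> 9\<close> keeps \<open>r ^ m\<close> away from 0 on the
    band.\<close>
  define m where "m = nat \<lceil>8 / e\<rceil>"
  have "0 < 8 / e" using e by simp
  then have m8: "8 / e \<le> m" "m \<le> 8 / e + 1" unfolding m_def by linarith+
  have m: "0 < m" using m8(1) \<open>0 < 8 / e\<close> by linarith
  have me: "8 \<le> m * e" "m * e \<le> 9"
    using m8 e by (auto simp: field_simps)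
  \<comment> \<open>\<open>b ^ 6 = sqrt A\<close> makes
    \<open>A * (m * pi / k)\<^sup>2 = (pi / 4)\<^sup>2\<close>, and the factor \<open>4 * m\<close>
    keeps the sector inside the cone.\<close>
  define k where "k = 4 * m * b ^ 6"
  have k: "0 < k" "4 * m \<le> k" using m b by (auto simp: k_def)
  define E where "E = peak_mass n A m e"
  have "\<eta> * moment n \<le> 1/2 * moment n" using \<eta> moment_pos[of n] by (intro mult_right_mono) auto
  then have ME: "moment n \<le> 2 * E"
    unfolding E_def using out A by (intro moment_le_peak_mass) auto
  then have E: "0 < E" using moment_pos[of n] by linarith
  define c where "c = X / E"
  have c: "0 < c" "c * E = X" using X E by (auto simp: c_def)
  define h where "h = peak c n A m"
  have norm_h: "norm (h z) \<le> c * norm z ^ n * exp A" if "norm z \<le> 1" for z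
    unfolding h_def using c A that by (intro norm_peak_le) auto
  have outE: "exp A * (\<eta> * moment n) \<le> q * E"
  proof -
    have "exp A * (\<eta> * moment n) = q * (moment n / 2)" by (simp add: \<eta>_def)
    also have "\<dots> \<le> q * E" using ME q by (intro mult_left_mono) auto
    finally show ?thesis .
  qed
  show ?thesis
  proof (intro exI[of _ h] conjI)
    show "h holomorphic_on UNIV" unfolding h_def by (rule peak_holomorphic)
    show "\<exists>G. \<forall>z\<in>unit_disc. norm (h z) \<le> G"
    proof (intro exI ballI)
      fix z :: complex assume "z \<in> unit_disc"
      then have "norm z \<le> 1" by simp
      have "norm (h z) \<le> c * norm z ^ n * exp A" by (rule norm_h) fact
      also have "\<dots> \<le> c * 1 * exp A"
        using c \<open>norm z \<le> 1\<close> by (intro mult_right_mono mult_left_mono power_le_one) auto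
      finally show "norm (h z) \<le> c * 1 * exp A" .
    qed
    show "\<forall>z\<in>cball 0 R. norm (h z) \<le> \<epsilon>"
    proof
      fix z :: complex assume "z \<in> cball 0 R"
      then have z: "norm z \<le> R" by simp
      have "norm (h z) \<le> c * norm z ^ n * exp A" using z assms by (intro norm_h) auto
      also have "\<dots> \<le> c * R ^ n * exp A"
        using c z by (intro mult_right_mono mult_left_mono power_mono) auto
      also have "c \<le> 2 * X / moment n"
        using ME E X moment_pos[of n] mult_left_mono[OF ME, of X] by (simp add: c_def field_simps)
      then have "c * R ^ n * exp A \<le> 2 * X / moment n * R ^ n * exp A"
        using assms by (intro mult_right_mono) auto
      also have "\<dots> = 2 * X * exp A * (R ^ n / moment n)" by simp
      also have "\<dots> \<le> \<epsilon>" using n0[OF n] by simp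
      finally show "norm (h z) \<le> \<epsilon>" .
    qed
    show "radially_small \<epsilon> h"
    proof -
      define S where "S = (\<Union>j\<in>{..m}. cball (2 * pi * real j / m) (\<delta> / m))"
      have S: "S \<in> sets borel" "emeasure lborel S \<le> ennreal (4 * \<delta>)"
        "\<And>\<theta>. \<theta> \<in> {0..2 * pi} \<Longrightarrow> \<theta> \<notin> S \<Longrightarrow> cos (real m * \<theta>) \<le> 1 - \<delta>\<^sup>2 / 8"
        unfolding S_def using peak_angles[OF m \<delta>] by blast+
      define u where "u \<theta> = sqrt (2 * X) * indicator S \<theta> + sqrt (2 * X * q)" for \<theta>
      have inner: "(\<integral>\<^sup>+r\<in>{0..<1}. ennreal (norm (h (of_real r * cis \<theta>)) * w r * r) \<partial>lborel) \<le> ennreal ((u \<theta>)\<^sup>2)"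
        if \<theta>: "\<theta> \<in> {0..2 * pi}" for \<theta>
      proof -
        define x where "x = cos (real m * \<theta>)"
        have eq: "(\<integral>\<^sup>+r\<in>{0..<1}. ennreal (norm (h (of_real r * cis \<theta>)) * w r * r) \<partial>lborel) =
          (\<integral>\<^sup>+r\<in>{0..<1}. ennreal (c * r ^ n * exp (A * r ^ m * x) * w r * r) \<partial>lborel)"
          using c by (intro nn_integral_cong) (auto simp: h_def norm_peak_polar x_def split: split_indicator)
        have le: "(\<integral>\<^sup>+r\<in>{0..<1}. ennreal (c * r ^ n * exp (A * r ^ m * x) * w r * r) \<partial>lborel) \<le> ennreal (2 * X * p)"
          if p: "q \<le> p" and pe: "\<And>r. r \<in> band e \<Longrightarrow> 0 < r \<Longrightarrow> r < 1 \<Longrightarrow> exp (A * r ^ m * x) \<le> p * exp (A * r ^ m)" for p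
        proof -
          have "(\<integral>\<^sup>+r\<in>{0..<1}. ennreal (c * r ^ n * exp (A * r ^ m * x) * w r * r) \<partial>lborel) \<le>
              ennreal (c * (p * E + exp A * (\<eta> * moment n)))"
            unfolding E_def using c A p q out pe by (intro radial_integral_le) (auto simp: x_def)
          also have "exp A * (\<eta> * moment n) \<le> p * E"
            using outE mult_right_mono[OF p, of E] E by linarith
          then have "c * (p * E + exp A * (\<eta> * moment n)) \<le> c * (p * E + p * E)"
            using c by (intro mult_left_mono add_left_mono) auto
          also have "c * (p * E + p * E) = 2 * X * p" unfolding c(2)[symmetric] by (simp add: algebra_simps)
          finally show ?thesis by (simp add: ennreal_leI)
        qed
        show ?thesis
        proof (cases "\<theta> \<in> S")
          case True
          have "(\<integral>\<^sup>+r\<in>{0..<1}. ennreal (c * r ^ n * exp (A * r ^ m * x) * w r * r) \<partial>lborel) \<le> ennreal (2 * X * 1)"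
          proof (rule le[OF q(2)])
            fix r :: real assume "0 < r"
            then have "A * r ^ m * x \<le> A * r ^ m * 1" using A by (intro mult_left_mono) (auto simp: x_def)
            then show "exp (A * r ^ m * x) \<le> 1 * exp (A * r ^ m)" by simp
          qed
          also have "2 * X * 1 = (sqrt (2 * X))\<^sup>2" using X by simp
          also have "\<dots> \<le> (u \<theta>)\<^sup>2" using True X q by (intro power_mono) (auto simp: u_def)
          finally show ?thesis unfolding eq by (simp add: ennreal_leI)
        next
          case False
          have "(\<integral>\<^sup>+r\<in>{0..<1}. ennreal (c * r ^ n * exp (A * r ^ m * x) * w r * r) \<partial>lborel) \<le> ennreal (2 * X * q)"
          proof (rule le[OF order_refl])
            fix r :: real assume r: "r \<in> band e" "0 < r" "r < 1"
            \<comment> \<open>Off \<open>S\<close> the exponent falls by at least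
              \<open>r ^ m * (A * \<delta>\<^sup>2) / 8\<close>, where
              \<open>A * \<delta>\<^sup>2 = b ^ 4\<close>; this is the origin of
              \<open>q\<close>.\<close>
            have "\<kappa> \<le> r ^ m" unfolding \<kappa>_def by (rule power_band_lower[OF e me(2) r(1)])
            then have "\<kappa> * (A * \<delta>\<^sup>2) \<le> r ^ m * (A * \<delta>\<^sup>2)" using A by (intro mult_right_mono) auto
            moreover have "A * \<delta>\<^sup>2 = real b ^ 4"
              using b by (simp add: A_def \<delta>_def power_divide power_mult[symmetric] field_simps flip: power_add)
            moreover have "A * r ^ m * x \<le> A * r ^ m * (1 - \<delta>\<^sup>2 / 8)"
              using A r S(3)[OF \<theta> False] by (intro mult_left_mono) (auto simp: x_def)
            moreover have "A * r ^ m * (1 - \<delta>\<^sup>2 / 8) = A * r ^ m - r ^ m * (A * \<delta>\<^sup>2) / 8"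
              by (simp add: algebra_simps)
            ultimately have "A * r ^ m * x \<le> - (\<kappa> * real b ^ 4 / 8) + A * r ^ m" by simp
            then have "exp (A * r ^ m * x) \<le> exp (- (\<kappa> * real b ^ 4 / 8) + A * r ^ m)" by simp
            then show "exp (A * r ^ m * x) \<le> q * exp (A * r ^ m)" by (simp only: q_def exp_add)
          qed
          also have "2 * X * q = (u \<theta>)\<^sup>2" using False X q by (simp add: u_def)
          finally show ?thesis unfolding eq .
        qed
      qed
      have [measurable]: "u \<in> borel_measurable borel" unfolding u_def[abs_def] using S(1) by measurable
      have u0: "0 \<le> u \<theta>" for \<theta> using X q by (simp add: u_def)
      have "(\<integral>\<^sup>+\<theta>\<in>{0..2 * pi}. ennreal (u \<theta>) \<partial>lborel) \<le>
          (\<integral>\<^sup>+\<theta>. ennreal (sqrt (2 * X)) * indicator S \<theta> + ennreal (sqrt (2 * X * q)) * indicator {0..2 * pi} \<theta> \<partial>lborel)"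
        using X q by (intro nn_integral_mono) (auto simp: u_def split: split_indicator simp flip: ennreal_plus)
      also have "\<dots> = ennreal (sqrt (2 * X)) * emeasure lborel S + ennreal (sqrt (2 * X * q)) * ennreal (2 * pi)"
        using S(1) by (subst nn_integral_add) (auto simp: nn_integral_cmult_indicator)
      also have "\<dots> \<le> ennreal (sqrt (2 * X)) * ennreal (4 * \<delta>) + ennreal (sqrt (2 * X * q)) * ennreal (2 * pi)"
        using S(2) by (intro add_right_mono mult_left_mono) auto
      also have "\<dots> = ennreal (sqrt (2 * X) * (4 * \<delta>) + sqrt (2 * X * q) * (2 * pi))"
        using X q \<delta> by (simp add: ennreal_mult ennreal_plus)
      also have "\<dots> \<le> ennreal \<epsilon>" using small by (intro ennreal_leI) (simp add: mult_ac)
      finally have "(\<integral>\<^sup>+\<theta>\<in>{0..2 * pi}. ennreal (u \<theta>) \<partial>lborel) \<le> ennreal \<epsilon>" .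
      then show ?thesis unfolding radially_small_def using inner u0 \<open>u \<in> borel_measurable borel\<close> by blast
    qed
    show "\<exists>R'<1. tent_large K R' h"
      unfolding tent_large_def
    proof (intro exI[of _ "1 - e / 2"] conjI allI)
      fix \<theta> :: real
      obtain j :: int where j: "\<bar>\<theta> - 2 * pi * j / m\<bar> \<le> pi / m"
        using ex_near_multiple[OF m] by blast
      let ?W = "sector (2 * pi * j / m) (pi / k) \<inter> norm -` band e"
      have "A * (m * pi / k)\<^sup>2 = (pi / 4)\<^sup>2"
        using b m by (simp add: A_def k_def power_divide power_mult_distrib power_mult[symmetric])
      also have "\<dots> \<le> 1" using pi_less_4 by (intro power_le_one) auto
      finally have phase: "A * (m * pi / k)\<^sup>2 \<le> 1" .
      have t: "cos (m * (2 * pi * j / m + v)) = cos (m * v)" for v :: real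
      proof -
        have "m * (2 * pi * j / m + v) = m * v + 2 * pi * j" using m by (simp add: field_simps)
        then show ?thesis by (simp only: cos_plus_two_pi_int)
      qed
      \<comment> \<open>The sector bound equals \<open>10 * pi * K / (3 * m * e)\<close>, which is
        at least \<open>K\<close> because \<open>m * e \<le> 9\<close> and \<open>pi > 3\<close>;
        hence the 20 in \<open>X\<close>.\<close>
      have "K * (9 * 1) \<le> K * (10 * pi / 3)" using \<open>0 < K\<close> pi_gt3 by (intro mult_left_mono) auto
      moreover have "K * (m * e) \<le> K * 9" using \<open>0 < K\<close> me by (intro mult_left_mono) auto
      ultimately have "K * (m * e) \<le> 10 * pi * K / 3" by (simp add: mult.commute)
      then have "K \<le> (10 * pi * K / 3) / (m * e)" using m e by (subst pos_le_divide_eq) auto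
      also have "\<dots> = c * E * (2 * pi / (3 * e * k))"
        unfolding c(2) using m e b by (simp add: X_def k_def mult_ac)
      finally have "ennreal K \<le> ennreal (c * peak_mass n A m e * (2 * pi / (3 * e * k)))"
        unfolding E_def by (rule ennreal_leI)
      also have "\<dots> \<le> (\<integral>\<^sup>+z\<in>?W. ennreal (norm (h z) * w (norm z) / (1 - norm z)) \<partial>lborel)"
        unfolding h_def using c A k e phase t by (intro sector_integral_ge) auto
      finally have "ennreal K \<le> \<dots>" .
      moreover have "?W \<subseteq> tent_region (cis \<theta>) \<inter> cball 0 (1 - e / 2)"
        using m k(2) e me(1) j by (rule sector_band_subset_tent)
      moreover have "?W \<in> sets borel"
      proof -
        have "(norm :: complex \<Rightarrow> real) -` band e \<inter> space borel \<in> sets borel"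
          by (rule measurable_sets[of _ borel borel]) auto
        then show ?thesis by (intro sets.Int sector_borel) simp
      qed
      ultimately show "\<exists>W\<in>sets borel. W \<subseteq> tent_region (cis \<theta>) \<inter> cball 0 (1 - e / 2) \<and>
        ennreal K \<le> (\<integral>\<^sup>+z\<in>W. ennreal (norm (h z) * w (norm z) / (1 - norm z)) \<partial>lborel)" by blast
    qed (use e in simp)
  qed
qed

end

section \<open>The gliding hump\<close>

text \<open>Each \<open>b k\<close> is at most the whole sum. Applied to the majorants
  \<open>u k\<close>, this bounds the sum of the inner integrals by one square.\<close>

lemma suminf_squares_le:
  fixes b :: "nat \<Rightarrow> ennreal"
  shows "(\<Sum>k. (b k)\<^sup>2) \<le> (\<Sum>k. b k)\<^sup>2"
proof -
  have "b k \<le> (\<Sum>k. b k)" for k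
    using sum_le_suminf[of b "{k}"] by simp
  then have "(\<Sum>k. (b k)\<^sup>2) \<le> (\<Sum>k. b k * (\<Sum>k. b k))"
    by (intro suminf_le) (auto simp: power2_eq_square intro: mult_left_mono)
  also have "\<dots> = (\<Sum>k. b k)\<^sup>2" by (simp add: power2_eq_square)
  finally show ?thesis .
qed

lemma ennreal_rpow_half_le:
  assumes "x \<le> y\<^sup>2"
  shows "ennreal_rpow x (1/2) \<le> y"
proof (cases "y = \<infinity>")
  case False
  then obtain b where b: "0 \<le> b" "y = ennreal b" by (cases y) auto
  then have x: "x \<le> ennreal (b\<^sup>2)" using assms by (simp add: ennreal_power)
  then have xf: "x \<noteq> \<infinity>" using le_less_trans[OF x ennreal_less_top] by auto
  have "enn2real x \<le> b\<^sup>2" using x by (simp add: enn2real_leI)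
  then have "sqrt (enn2real x) \<le> b" using b real_le_lsqrt by force
  then show ?thesis using xf b by (simp add: ennreal_rpow_def powr_half_sqrt ennreal_leI)
qed simp

context decaying_profile
begin

text \<open>A state holds the partial sum, the latest hump and a radius. A new hump is tiny inside
  the radius reached so far, so earlier cone estimates survive, and its own cone integrals outweigh
  the partial sum, which is bounded on the disc.\<close>

lemma gliding_hump:
  "\<exists>f U. f holomorphic_on unit_disc \<and> U \<in> borel_measurable borel \<and>
     (\<forall>\<theta>\<in>{0..2 * pi}. (\<integral>\<^sup>+r\<in>{0..<1}. ennreal (norm (f (of_real r * cis \<theta>)) * w r * r) \<partial>lborel) \<le> (U \<theta>)\<^sup>2) \<and>
     (\<integral>\<^sup>+\<theta>\<in>{0..2 * pi}. U \<theta> \<partial>lborel) < \<infinity> \<and>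
     (\<forall>\<theta>. (\<integral>\<^sup>+z\<in>tent_region (cis \<theta>). ennreal (norm (f z) * w (norm z) / (1 - norm z)) \<partial>lborel) = \<infinity>)"
proof -
  \<comment> \<open>Decay of order 1 cancels \<open>1 / (1 - norm z)\<close>, so a function bounded
    by \<open>a\<close> contributes at most \<open>a * C\<close> to any cone integral.\<close>
  obtain C1 where C1: "\<forall>r\<in>{0..<1}. w r \<le> C1 * (1 - r) ^ 1" using decay[of 1] by blast
  have C1_pos: "0 < C1" using C1 positive[of 0] by force
  have v_le: "w (norm z) / (1 - norm z) \<le> C1" if "z \<in> unit_disc" for z :: complex
    using C1 that by (auto simp: pos_divide_le_eq)
  define C where "C = C1 * pi"
  have C: "0 < C" using C1_pos by (simp add: C_def)
  \<comment> \<open>The lower bound on \<open>R\<close> forces the radii to tend to 1.\<close>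
  define P where "P k s \<longleftrightarrow> (case s of (g, h, R) \<Rightarrow> (g :: complex \<Rightarrow> complex) holomorphic_on UNIV \<and>
      h holomorphic_on UNIV \<and> (k = 0 \<longrightarrow> g = (\<lambda>_. 0)) \<and>
      (\<exists>G. \<forall>z\<in>unit_disc. norm (g z) \<le> G) \<and> 0 < R \<and> 1 - 1 / (real k + 1) \<le> R \<and> R < (1 :: real))"
    for k :: nat and s :: "(complex \<Rightarrow> complex) \<times> (complex \<Rightarrow> complex) \<times> real"
  \<comment> \<open>In \<open>G + 2\<close>, \<open>G\<close> accounts for the partial sum and 2 for
    all later humps; \<open>k\<close> is the surplus left to the limit function.\<close>
  define Q where "Q k s s' \<longleftrightarrow> (case s of (g, h, R) \<Rightarrow> case s' of (g', h', R') \<Rightarrow>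
      g' = (\<lambda>z. g z + h' z) \<and> R \<le> R' \<and> (\<forall>z\<in>cball 0 R. norm (h' z) \<le> (1/2) ^ k) \<and> radially_small ((1/2) ^ k) h' \<and>
      (\<exists>G\<ge>0. (\<forall>z\<in>unit_disc. norm (g z) \<le> G) \<and> tent_large (real k + (G + 2) * C) R' h'))"
    for k :: nat and s s' :: "(complex \<Rightarrow> complex) \<times> (complex \<Rightarrow> complex) \<times> real"
  have "\<exists>x. P 0 x"
    by (intro exI[of _ "(\<lambda>_. 0, \<lambda>_. 0, 1/2)"]) (auto simp: P_def)
  moreover have "\<exists>y. P (Suc k) y \<and> Q k x y" if Px: "P k x" for x k
  proof -
    obtain g h R where x: "x = (g, h, R)" by (cases x) auto
    obtain G0 where g: "g holomorphic_on UNIV" and G0: "\<forall>z\<in>unit_disc. norm (g z) \<le> G0"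
      and R: "0 < R" "R < 1" using Px by (auto simp: P_def x)
    define G where "G = max 0 G0"
    have G: "0 \<le> G" "\<forall>z\<in>unit_disc. norm (g z) \<le> G" using G0 by (auto simp: G_def le_max_iff_disj)
    have K: "0 < real k + (G + 2) * C" using G C by (intro add_nonneg_pos) auto
    obtain h' where h': "h' holomorphic_on UNIV" "\<exists>G. \<forall>z\<in>unit_disc. norm (h' z) \<le> G"
        "\<forall>z\<in>cball 0 R. norm (h' z) \<le> (1/2) ^ k" "radially_small ((1/2) ^ k) h'"
        "\<exists>R'<1. tent_large (real k + (G + 2) * C) R' h'"
      using test_function[of "(1/2) ^ k", OF _ R K] by auto
    obtain G' where G': "\<forall>z\<in>unit_disc. norm (h' z) \<le> G'" using h'(2) by blast
    obtain R1 where R1: "R1 < 1" "tent_large (real k + (G + 2) * C) R1 h'" using h'(5) by blast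
    define R' where "R' = max R1 (max R (1 - 1 / (real (Suc k) + 1)))"
    have R': "R1 \<le> R'" "R \<le> R'" "1 - 1 / (real (Suc k) + 1) \<le> R'" "R' < 1"
      using R1(1) R(2) by (auto simp: R'_def)
    have big: "tent_large (real k + (G + 2) * C) R' h'" using R1(2) R'(1) by (rule tent_large_mono)
    have "\<forall>z\<in>unit_disc. norm (g z + h' z) \<le> G + G'"
      using G(2) G' by (auto intro: norm_triangle_le add_mono)
    then have "\<exists>G. \<forall>z\<in>unit_disc. norm (g z + h' z) \<le> G" by blast
    then have "P (Suc k) (\<lambda>z. g z + h' z, h', R')"
      using g h'(1) R' R unfolding P_def by (auto intro!: holomorphic_intros)
    moreover have "Q k x (\<lambda>z. g z + h' z, h', R')"
      unfolding Q_def x using R'(2) h'(3,4) G big by auto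
    ultimately show ?thesis by blast
  qed
  ultimately obtain s where s: "\<And>k. P k (s k)" "\<And>k. Q k (s k) (s (Suc k))"
    using dependent_nat_choice[of P Q] by blast
  \<comment> \<open>The hump chosen at step \<open>k\<close> is stored in state
    \<open>Suc k\<close>, hence the shift in \<open>h\<close>.\<close>
  define g h R where "g k = fst (s k)" and "h k = fst (snd (s (Suc k)))" and "R k = snd (snd (s k))" for k
  have sk: "s k = (g k, fst (snd (s k)), R k)" for k by (simp add: g_def R_def)
  have hol: "h k holomorphic_on UNIV" for k
    using s(1)[of "Suc k"] by (auto simp: P_def h_def split: prod.splits)
  have R: "0 < R k" "1 - 1 / (real k + 1) \<le> R k" "R k < 1" for k
    using s(1)[of k] sk[of k] by (auto simp: P_def split: prod.splits)
  have step: "g (Suc k) = (\<lambda>z. g k z + h k z)" "R k \<le> R (Suc k)"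
    "\<forall>z\<in>cball 0 (R k). norm (h k z) \<le> (1/2) ^ k" "radially_small ((1/2) ^ k) (h k)"
    "\<exists>G\<ge>0. (\<forall>z\<in>unit_disc. norm (g k z) \<le> G) \<and> tent_large (real k + (G + 2) * C) (R (Suc k)) (h k)" for k
    using s(2)[of k] by (auto simp: Q_def g_def h_def R_def split: prod.splits)
  have "g 0 = (\<lambda>_. 0)" using s(1)[of 0] by (auto simp: P_def g_def split: prod.splits)
  then have g_sum: "g k z = (\<Sum>i<k. h i z)" for k z
    by (induction k) (auto simp: step(1))
  have Rmono: "R j \<le> R k" if "j \<le> k" for j k using lift_Suc_mono_le[of R, OF step(2) that] .
  have h_le: "norm (h i z) \<le> (1/2) ^ i" if "z \<in> cball 0 (R k)" "k \<le> i" for i k z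
    using step(3)[of i] Rmono[OF that(2)] that(1) by auto
  have R_ex: "\<exists>k. x \<le> R k" if "x < 1" for x
  proof -
    obtain k :: nat where k: "1 / (1 - x) < real k" using reals_Archimedean2 by blast
    then have "1 < real k * (1 - x)" using that by (simp add: pos_divide_less_eq)
    also have "\<dots> \<le> (real k + 1) * (1 - x)" using that by (intro mult_right_mono) auto
    finally have "1 / (real k + 1) \<le> 1 - x" by (simp add: field_simps)
    then show ?thesis using R(2)[of k] by (intro exI[of _ k]) linarith
  qed
  have half: "summable (\<lambda>i. (1/2::real) ^ i)" by (rule summable_geometric) simp
  define f where "f z = (\<Sum>i. h i z)" for z
  have summ: "summable (\<lambda>i. norm (h i z))" if z: "z \<in> unit_disc" for z
  proof -
    obtain k where k: "norm z \<le> R k" using R_ex[of "norm z"] z by auto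
    show ?thesis
      by (rule summable_comparison_test'[OF half, of k]) (use h_le[of z k] k in auto)
  qed
  have ul: "uniform_limit (cball 0 (R k)) (\<lambda>n z. \<Sum>i<n. h i z) f sequentially" for k
    unfolding f_def
    by (rule Weierstrass_m_test_ev[OF _ half])
      (use h_le[of _ k] in \<open>auto intro!: eventually_sequentiallyI[of k]\<close>)
  have f_hol: "f holomorphic_on unit_disc"
  proof (rule holomorphic_uniform_sequence)
    show "(\<lambda>z. \<Sum>i<n. h i z) holomorphic_on unit_disc" for n
      by (intro holomorphic_intros holomorphic_on_subset[OF hol]) auto
    fix x :: complex assume "x \<in> unit_disc"
    then have x: "norm x < 1" by simp
    define d where "d = (1 - norm x) / 2"
    have d: "0 < d" "norm x + d < 1" using x by (auto simp: d_def field_simps)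
    obtain k where k: "norm x + d \<le> R k" using R_ex[OF d(2)] by blast
    have sub: "cball x d \<subseteq> cball 0 (R k)"
    proof
      fix y assume "y \<in> cball x d"
      then have "norm (y - x) \<le> d" by (simp add: dist_norm norm_minus_commute)
      then show "y \<in> cball 0 (R k)" using norm_triangle_ineq[of "y - x" x] k by simp
    qed
    moreover have "cball 0 (R k) \<subseteq> unit_disc" using R(3)[of k] by auto
    ultimately show "\<exists>d>0. cball x d \<subseteq> unit_disc \<and> uniform_limit (cball x d) (\<lambda>n z. \<Sum>i<n. h i z) f sequentially"
      using d(1) uniform_limit_on_subset[OF ul sub] by (intro exI[of _ d]) blast
  qed simp
  have "\<exists>u. \<forall>k. u k \<in> borel_measurable borel \<and> (\<forall>\<theta>. 0 \<le> u k \<theta>) \<and>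
      (\<forall>\<theta>\<in>{0..2 * pi}. (\<integral>\<^sup>+r\<in>{0..<1}. ennreal (norm (h k (of_real r * cis \<theta>)) * w r * r) \<partial>lborel) \<le> ennreal ((u k \<theta>)\<^sup>2)) \<and>
      (\<integral>\<^sup>+\<theta>\<in>{0..2 * pi}. ennreal (u k \<theta>) \<partial>lborel) \<le> ennreal ((1/2) ^ k)"
    using step(4) unfolding radially_small_def Bex_def by (intro choice allI) blast
  then obtain u where u_meas [measurable]: "\<And>k. u k \<in> borel_measurable borel" and u0: "\<And>k \<theta>. 0 \<le> u k \<theta>"
    and u_inner: "\<And>\<theta> k. \<theta> \<in> {0..2 * pi} \<Longrightarrow>
      (\<integral>\<^sup>+r\<in>{0..<1}. ennreal (norm (h k (of_real r * cis \<theta>)) * w r * r) \<partial>lborel) \<le> ennreal ((u k \<theta>)\<^sup>2)"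
    and u_int: "\<And>k. (\<integral>\<^sup>+\<theta>\<in>{0..2 * pi}. ennreal (u k \<theta>) \<partial>lborel) \<le> ennreal ((1/2) ^ k)"
    by blast
  define U where "U \<theta> = (\<Sum>k. ennreal (u k \<theta>))" for \<theta>
  have U_meas: "U \<in> borel_measurable borel" unfolding U_def by measurable
  have cont_h: "continuous_on UNIV (h k)" for k using hol holomorphic_on_imp_continuous_on by blast
  have inner: "(\<integral>\<^sup>+r\<in>{0..<1}. ennreal (norm (f (of_real r * cis \<theta>)) * w r * r) \<partial>lborel) \<le> (U \<theta>)\<^sup>2"
    if \<theta>: "\<theta> \<in> {0..2 * pi}" for \<theta>
  proof -
    \<comment> \<open>The inner indicator makes the profile Borel on the whole line, so that sum and
      integral can be exchanged.\<close>
    let ?H = "\<lambda>k r. ennreal (norm (h k (of_real r * cis \<theta>)) * (w r * indicator {0..<1} r) * r) * indicator {0..<1} r"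
    have [measurable]: "(\<lambda>r. norm (h k (of_real r * cis \<theta>))) \<in> borel_measurable borel" for k
      by (intro borel_measurable_continuous_onI continuous_intros
          continuous_on_compose2[OF cont_h]) auto
    have "(\<integral>\<^sup>+r\<in>{0..<1}. ennreal (norm (f (of_real r * cis \<theta>)) * w r * r) \<partial>lborel) \<le>
        (\<integral>\<^sup>+r. (\<Sum>k. ?H k r) \<partial>lborel)"
    proof (rule nn_integral_mono)
      fix r :: real
      show "ennreal (norm (f (of_real r * cis \<theta>)) * w r * r) * indicator {0..<1} r \<le> (\<Sum>k. ?H k r)"
      proof (cases "r \<in> {0..<1}")
        case True
        let ?z = "of_real r * cis \<theta>"
        have z: "?z \<in> unit_disc" using True by (simp add: norm_mult)
        have wr: "0 \<le> w r * r" using True positive[of r] by (auto intro: mult_nonneg_nonneg less_imp_le)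
        have "norm (f ?z) * (w r * r) \<le> (\<Sum>k. norm (h k ?z)) * (w r * r)"
          unfolding f_def using summable_norm[OF summ[OF z]] wr by (intro mult_right_mono)
        also have "\<dots> = (\<Sum>k. norm (h k ?z) * (w r * r))" by (rule suminf_mult2[OF summ[OF z]])
        finally have "ennreal (norm (f ?z) * (w r * r)) \<le> ennreal (\<Sum>k. norm (h k ?z) * (w r * r))"
          by (rule ennreal_leI)
        also have "\<dots> = (\<Sum>k. ennreal (norm (h k ?z) * (w r * r)))"
          using wr by (intro suminf_ennreal2[symmetric] summable_mult2[OF summ[OF z]]) auto
        finally show ?thesis using True by (simp add: mult.assoc)
      qed simp
    qed
    also have "\<dots> = (\<Sum>k. \<integral>\<^sup>+r. ?H k r \<partial>lborel)"
      by (rule nn_integral_suminf) measurable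
    also have "\<dots> \<le> (\<Sum>k. (ennreal (u k \<theta>))\<^sup>2)"
    proof (intro suminf_le allI)
      fix k
      have "(\<integral>\<^sup>+r. ?H k r \<partial>lborel) = (\<integral>\<^sup>+r\<in>{0..<1}. ennreal (norm (h k (of_real r * cis \<theta>)) * w r * r) \<partial>lborel)"
        by (rule nn_integral_cong) (simp split: split_indicator)
      then show "(\<integral>\<^sup>+r. ?H k r \<partial>lborel) \<le> (ennreal (u k \<theta>))\<^sup>2"
        using u_inner[OF \<theta>, of k] u0[of k \<theta>] by (simp add: ennreal_power)
    qed auto
    also have "\<dots> \<le> (U \<theta>)\<^sup>2" unfolding U_def by (rule suminf_squares_le)
    finally show ?thesis .
  qed
  have U_int: "(\<integral>\<^sup>+\<theta>\<in>{0..2 * pi}. U \<theta> \<partial>lborel) < \<infinity>"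
  proof -
    have "(\<integral>\<^sup>+\<theta>\<in>{0..2 * pi}. U \<theta> \<partial>lborel) = (\<integral>\<^sup>+\<theta>. (\<Sum>k. ennreal (u k \<theta>) * indicator {0..2 * pi} \<theta>) \<partial>lborel)"
      by (simp add: U_def)
    also have "\<dots> = (\<Sum>k. \<integral>\<^sup>+\<theta>\<in>{0..2 * pi}. ennreal (u k \<theta>) \<partial>lborel)"
      by (rule nn_integral_suminf) measurable
    also have "\<dots> \<le> (\<Sum>k. ennreal ((1/2) ^ k))" using u_int by (intro suminf_le) auto
    also have "\<dots> = ennreal (\<Sum>k. (1/2) ^ k)" using half by (intro suminf_ennreal2) auto
    also have "\<dots> < \<infinity>" by simp
    finally show ?thesis .
  qed
  \<comment> \<open>Extended by 0, \<open>F\<close> and \<open>V\<close> are Borel on the plane,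
    which the splitting of the integral below requires.\<close>
  define F where "F z = indicator unit_disc z * norm (f z)" for z
  define V where "V z = w (norm z) * indicator {0..<1} (norm z) / (1 - norm z)" for z :: complex
  have [measurable]: "F \<in> borel_measurable borel"
  proof -
    have "continuous_on unit_disc (\<lambda>z. norm (f z))"
      by (intro continuous_intros holomorphic_on_imp_continuous_on f_hol)
    then have "(\<lambda>z. indicator unit_disc z *\<^sub>R norm (f z)) \<in> borel_measurable borel"
      by (intro borel_measurable_continuous_on_indicator) auto
    then show ?thesis by (simp add: F_def[abs_def])
  qed
  have [measurable]: "V \<in> borel_measurable borel" unfolding V_def[abs_def] by measurable
  have V: "0 \<le> V z" "z \<in> unit_disc \<Longrightarrow> V z = w (norm z) / (1 - norm z)" "V z \<le> C1 * indicator unit_disc z" for z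
    using positive[of "norm z"] v_le[of z] by (auto simp: V_def split: split_indicator)
  have V_int: "(\<integral>\<^sup>+z. ennreal (a * V z) \<partial>lborel) \<le> ennreal (a * C)" if "0 \<le> a" for a
  proof -
    have "(\<integral>\<^sup>+z. ennreal (a * V z) \<partial>lborel) \<le> (\<integral>\<^sup>+z. ennreal (a * C1) * indicator unit_disc (z :: complex) \<partial>lborel)"
    proof (rule nn_integral_mono)
      fix z :: complex
      have "a * V z \<le> a * (C1 * indicator unit_disc z)" using V(3) that by (rule mult_left_mono)
      then have "ennreal (a * V z) \<le> ennreal (a * (C1 * indicator unit_disc z))" by (rule ennreal_leI)
      then show "ennreal (a * V z) \<le> ennreal (a * C1) * indicator unit_disc z" by (simp split: split_indicator_asm split_indicator)
    qed
    also have "\<dots> = ennreal (a * C)"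
      using that C1_pos by (simp add: nn_integral_cmult_indicator emeasure_ball unit_ball_vol_2 C_def mult.assoc flip: ennreal_mult)
    finally show ?thesis .
  qed
  have tent: "(\<integral>\<^sup>+z\<in>tent_region (cis \<theta>). ennreal (norm (f z) * w (norm z) / (1 - norm z)) \<partial>lborel) = \<infinity>" for \<theta>
  proof -
    let ?I = "\<integral>\<^sup>+z\<in>tent_region (cis \<theta>). ennreal (norm (f z) * w (norm z) / (1 - norm z)) \<partial>lborel"
    have "ennreal (real k) \<le> ?I" for k
    proof -
      obtain G where G: "0 \<le> G" "\<forall>z\<in>unit_disc. norm (g k z) \<le> G"
        and big: "tent_large (real k + (G + 2) * C) (R (Suc k)) (h k)"
        using step(5) by blast
      obtain W where W[measurable]: "W \<in> sets borel" and Wsub: "W \<subseteq> tent_region (cis \<theta>) \<inter> cball 0 (R (Suc k))"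
        and WK: "ennreal (real k + (G + 2) * C) \<le> (\<integral>\<^sup>+z\<in>W. ennreal (norm (h k z) * w (norm z) / (1 - norm z)) \<partial>lborel)"
        using big unfolding tent_large_def by blast
      have Wd: "z \<in> unit_disc" if "z \<in> W" for z using that Wsub by (auto simp: tent_region_def)
      have h_bound: "norm (h k z) \<le> F z + (G + 2)" if z: "z \<in> W" for z
      proof -
        have zR: "z \<in> cball 0 (R (Suc k))" using z Wsub by blast
        have sh: "summable (\<lambda>i. h i z)" using summ[OF Wd[OF z]] by (rule summable_norm_cancel)
        have "f z = (\<Sum>i. h (i + Suc k) z) + (\<Sum>i<Suc k. h i z)"
          unfolding f_def by (rule suminf_split_initial_segment[OF sh])
        then have hk: "h k z = f z - (\<Sum>i. h (i + Suc k) z) - g k z" by (simp add: g_sum)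
        \<comment> \<open>\<open>W\<close> lies in \<open>cball 0 (R (Suc k))\<close>, where every
          hump of index at least \<open>Suc k\<close> obeys its geometric bound.\<close>
        have "norm (\<Sum>i. h (i + Suc k) z) \<le> (\<Sum>i. (1/2) ^ i)"
        proof (rule norm_suminf_le[OF _ half])
          fix i
          have "norm (h (i + Suc k) z) \<le> (1/2) ^ (i + Suc k)" by (rule h_le[OF zR]) simp
          also have "\<dots> \<le> (1/2) ^ i" by (rule power_decreasing) auto
          finally show "norm (h (i + Suc k) z) \<le> (1/2) ^ i" .
        qed
        also have "(\<Sum>i. (1/2 :: real) ^ i) = 2" by (subst suminf_geometric) auto
        finally have t: "norm (\<Sum>i. h (i + Suc k) z) \<le> 2" .
        have "norm (h k z) \<le> norm (f z) + norm (\<Sum>i. h (i + Suc k) z) + norm (g k z)"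
          unfolding hk using norm_triangle_ineq4[of "f z - (\<Sum>i. h (i + Suc k) z)" "g k z"]
            norm_triangle_ineq4[of "f z" "\<Sum>i. h (i + Suc k) z"] by linarith
        then show ?thesis using t G(2) Wd[OF z] by (force simp: F_def)
      qed
      \<comment> \<open>The error \<open>G + 2\<close> is integrated over the whole disc instead of
        \<open>W\<close>; its finite bound \<open>(G + 2) * C\<close> then cancels on both
        sides.\<close>
      have "ennreal (real k) + ennreal ((G + 2) * C) = ennreal (real k + (G + 2) * C)"
        using G C by (simp add: ennreal_plus)
      also note WK
      also have "(\<integral>\<^sup>+z\<in>W. ennreal (norm (h k z) * w (norm z) / (1 - norm z)) \<partial>lborel) \<le>
          (\<integral>\<^sup>+z. ennreal (F z * V z) * indicator W z + ennreal ((G + 2) * V z) \<partial>lborel)"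
      proof (rule nn_integral_mono)
        fix z :: complex
        show "ennreal (norm (h k z) * w (norm z) / (1 - norm z)) * indicator W z \<le>
            ennreal (F z * V z) * indicator W z + ennreal ((G + 2) * V z)"
        proof (cases "z \<in> W")
          case True
          have "norm (h k z) * V z \<le> (F z + (G + 2)) * V z" using h_bound[OF True] V(1) by (rule mult_right_mono)
          also have "\<dots> = F z * V z + (G + 2) * V z" by (rule distrib_right)
          finally have "norm (h k z) * w (norm z) / (1 - norm z) \<le> F z * V z + (G + 2) * V z"
            unfolding V(2)[OF Wd[OF True]] by simp
          then have "ennreal (norm (h k z) * w (norm z) / (1 - norm z)) \<le> ennreal (F z * V z + (G + 2) * V z)"
            by (rule ennreal_leI)
          also have "\<dots> = ennreal (F z * V z) + ennreal ((G + 2) * V z)"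
            using V(1) G by (intro ennreal_plus mult_nonneg_nonneg) (auto simp: F_def)
          finally show ?thesis using True by simp
        qed simp
      qed
      also have "\<dots> = (\<integral>\<^sup>+z\<in>W. ennreal (F z * V z) \<partial>lborel) + (\<integral>\<^sup>+z. ennreal ((G + 2) * V z) \<partial>lborel)"
        by (rule nn_integral_add) measurable
      also have "\<dots> \<le> ?I + ennreal ((G + 2) * C)"
      proof (intro add_mono V_int nn_integral_mono)
        fix z :: complex
        show "ennreal (F z * V z) * indicator W z \<le>
            ennreal (norm (f z) * w (norm z) / (1 - norm z)) * indicator (tent_region (cis \<theta>)) z"
        proof (cases "z \<in> W")
          case True
          then have "z \<in> tent_region (cis \<theta>)" using Wsub by blast
          then show ?thesis using True V(2)[OF Wd[OF True]] Wd[OF True] by (simp add: F_def)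
        qed simp
      qed (use G in simp)
      finally show ?thesis by (simp add: ennreal_add_left_cancel_le add.commute)
    qed
    then have "\<not> ?I < of_nat k" for k by (simp add: ennreal_of_nat_eq_real_of_nat not_less)
    then show ?thesis using ennreal_Ex_less_of_nat[of ?I] less_top by auto
  qed
  show ?thesis using f_hol U_meas inner U_int tent by blast
qed

end

section \<open>Transfer to the two spaces\<close>

theorem theorem1p4:
  fixes \<mu> :: "complex \<Rightarrow> real"
  assumes "\<mu> \<in> rapidly_decreasing_weights"
  shows "\<exists>p q :: real. 0 < p \<and> 0 < q \<and> AT_space p q \<mu> \<noteq> AL_space p q \<mu>"
proof -
  note \<mu> = rapidly_decreasing_weight_decay[OF assms]
  define w where "w r = \<mu> (of_real r)" for r
  interpret decaying_profile w
  proof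
    show "continuous_on {0..<1} w"
      unfolding w_def by (rule continuous_on_compose2[OF \<mu>(2)]) (auto intro!: continuous_intros)
    show "0 < w r" if "0 \<le> r" "r < 1" for r using \<mu>(3)[of "of_real r"] that by (simp add: w_def)
    show "\<exists>C. \<forall>r\<in>{0..<1}. w r \<le> C * (1 - r) ^ k" for k using \<mu>(4) by (simp add: w_def)
  qed
  obtain f U where hol: "f holomorphic_on unit_disc" and U: "U \<in> borel_measurable borel"
    and inner: "\<And>\<theta>. \<theta> \<in> {0..2 * pi} \<Longrightarrow>
      (\<integral>\<^sup>+r\<in>{0..<1}. ennreal (norm (f (of_real r * cis \<theta>)) * w r * r) \<partial>lborel) \<le> (U \<theta>)\<^sup>2"
    and U_int: "(\<integral>\<^sup>+\<theta>\<in>{0..2 * pi}. U \<theta> \<partial>lborel) < \<infinity>"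
    and tent: "\<And>\<theta>. (\<integral>\<^sup>+z\<in>tent_region (cis \<theta>). ennreal (norm (f z) * w (norm z) / (1 - norm z)) \<partial>lborel) = \<infinity>"
    using gliding_hump by blast
  have meas: "f \<in> borel_measurable (lebesgue_on unit_disc)"
    by (intro continuous_imp_measurable_on_sets_lebesgue holomorphic_on_imp_continuous_on hol) auto
  have "L_norm 1 (1/2) \<mu> f < \<infinity>"
  proof -
    have "(\<integral>\<^sup>+\<theta>\<in>{0..2 * pi}. ennreal_rpow
         (\<integral>\<^sup>+r\<in>{0..<1}. ennreal (norm (f (of_real r * cis \<theta>)) powr 1 * \<mu> (of_real r) * r) \<partial>lebesgue)
         (1/2 / 1) \<partial>lebesgue) \<le> (\<integral>\<^sup>+\<theta>\<in>{0..2 * pi}. U \<theta> \<partial>lborel)"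
      \<comment> \<open>\<open>lebesgue\<close> is the completion of \<open>lborel\<close>, and
        nonnegative integrals over the two agree for arbitrary functions, measurable or not.\<close>
      unfolding nn_integral_completion
    proof (rule nn_integral_mono)
      fix \<theta> :: real
      show "ennreal_rpow
         (\<integral>\<^sup>+r\<in>{0..<1}. ennreal (norm (f (of_real r * cis \<theta>)) powr 1 * \<mu> (of_real r) * r) \<partial>lborel)
         (1/2 / 1) * indicator {0..2 * pi} \<theta> \<le> U \<theta> * indicator {0..2 * pi} \<theta>"
        using ennreal_rpow_half_le[OF inner[of \<theta>]] by (simp add: w_def split: split_indicator)
    qed
    also note U_int
    finally show ?thesis
      unfolding L_norm_def by (subst ennreal_rpow_def) (auto simp: ennreal_mult_eq_top_iff)
  qed
  moreover have "T_norm 1 (1/2) \<mu> f = \<infinity>"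
  proof -
    have "(\<integral>\<^sup>+z\<in>tent_region (cis \<theta>). ennreal (norm (f z) powr 1 * \<mu> z / (1 - norm z)) \<partial>lborel) = \<infinity>" for \<theta>
    proof -
      have "(\<integral>\<^sup>+z\<in>tent_region (cis \<theta>). ennreal (norm (f z) powr 1 * \<mu> z / (1 - norm z)) \<partial>lborel) =
          (\<integral>\<^sup>+z\<in>tent_region (cis \<theta>). ennreal (norm (f z) * w (norm z) / (1 - norm z)) \<partial>lborel)"
      proof (rule nn_integral_cong)
        fix z :: complex
        have "\<mu> z = w (norm z)" if "z \<in> unit_disc" using \<mu>(1) that unfolding radial_def w_def by blast
        then show "ennreal (norm (f z) powr 1 * \<mu> z / (1 - norm z)) * indicator (tent_region (cis \<theta>)) z =
            ennreal (norm (f z) * w (norm z) / (1 - norm z)) * indicator (tent_region (cis \<theta>)) z"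
          by (auto simp: tent_region_def split: split_indicator)
      qed
      then show ?thesis by (simp only: tent)
    qed
    then have "(\<integral>\<^sup>+\<theta>\<in>{0..2 * pi}. ennreal_rpow (ennreal (1 / pi) *
        (\<integral>\<^sup>+z\<in>tent_region (cis \<theta>). ennreal (norm (f z) powr 1 * \<mu> z / (1 - norm z)) \<partial>lebesgue)) (1/2 / 1) \<partial>lebesgue)
        = (\<integral>\<^sup>+\<theta>. \<infinity> * indicator {0..2 * pi} (\<theta> :: real) \<partial>lborel)"
      unfolding nn_integral_completion
      by (intro nn_integral_cong) (simp add: ennreal_rpow_def ennreal_mult_top)
    also have "\<dots> = \<infinity>"
      by (subst nn_integral_cmult_indicator) (auto simp: ennreal_top_mult)
    finally show ?thesis unfolding T_norm_def by (simp add: ennreal_rpow_def)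
  qed
  ultimately have "f \<in> AL_space 1 (1/2) \<mu>" "f \<notin> AT_space 1 (1/2) \<mu>"
    using meas hol by (auto simp: AL_space_def L_space_def AT_space_def T_space_def)
  then show ?thesis by (intro exI[of _ 1] exI[of _ "1/2"]) auto
qed

end
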